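(* Let $m,n\in\mathbb N$ with $m\equiv n\pmod 2$, and let $\sigma\in\mathcal B_{nm}$ with $r=\operatorname{rank}(\sigma)$. If $m\geq n$, then the rank and idempotent rank of the idempotent-generated semigroup $\mathbb E(\mathcal B_{mn}^\sigma)$ are given by $$\operatorname{rank}(\mathbb E(\mathcal B_{mn}^\sigma))=\operatorname{idrank}(\mathbb E(\mathcal B_{mn}^\sigma))=\frac{(m+r-1)!!}{(2r-1)!!}+\binom r2.$$
   Context: $\mathbb N=\{0,1,2,\ldots\}$, $[n]=\{1,\ldots,n\}$ (with $[0]=\emptyset$), and $A'=\{a':a\in A\}$, $A''=\{a'':a\in A\}$ for $A\subseteq\mathbb N$. For $m,n\in\mathbb N$, $\mathcal B_{mn}$ is the set of all Brauer partitions, i.e. set partitions of $[m]\cup[n]'$ into blocks of size $2$. For $\alpha\in\mathcal B_{mn}$ and $\beta\in\mathcal B_{nk}$, the product $\alpha\beta\in\mathcal B_{mk}$ is formed as follows: view partitions as graphs whose connected components are the blocks; let $\alpha_\downarrow$ be the graph on $[m]\cup[n]''$ obtained from $\alpha$ by renaming each $x'$ to $x''$, let $\beta^\uparrow$ be the graph on $[n]''\cup[k]'$ obtained from $\beta$ by renaming each $x\in[n]$ to $x''$, and let $\Pi(\alpha,\beta)$ be the union of these graphs on $[m]\cup[n]''\cup[k]'$; two elements of $[m]\cup[k]'$ lie in the same block of $\alpha\beta$ iff they lie in the same connected component of $\Pi(\alpha,\beta)$. The rank of a partition $\alpha\in\mathcal B_{mn}$ is the number of blocks of $\alpha$ meeting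 both $[m]$ and $[n]'$. For $\sigma\in\mathcal B_{nm}$, the sandwich semigroup $\mathcal B_{mn}^\sigma$ is the set $\mathcal B_{mn}$ with the associative operation $\alpha\star_\sigma\beta=\alpha\sigma\beta$. For a semigroup $T$, $\mathbb E(T)$ is the subsemigroup of $T$ generated by all idempotents of $T$; $\operatorname{rank}(T)$ is the minimum size of a (semigroup) generating set for $T$; and, if $T$ is idempotent-generated, $\operatorname{idrank}(T)$ is the minimum size of a generating set for $T$ consisting of idempotents. For odd $k\ge1$, $k!!=k(k-2)\cdots3\cdot1$, and $(-1)!!=1$. *)

theory Defs
  imports Complex_Main "HOL-Library.Disjoint_Sets"
begin

section \<open>Double factorials\<close>

text \<open>On integers, so that \<open>(-1)!! = 1\<close> is covered. The recursion is only meaningful for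
  odd arguments \<open>\<ge> -1\<close>, which are the only ones that are used.\<close>

function dfact :: "int \<Rightarrow> nat" where
  "dfact k = (if k \<le> 0 then 1 else nat k * dfact (k - 2))"
  by pat_completeness auto
termination by (relation "measure nat") auto

declare dfact.simps [simp del]

section \<open>Semigroups given by a carrier and an operation\<close>

inductive_set gen :: "('a \<Rightarrow> 'a \<Rightarrow> 'a) \<Rightarrow> 'a set \<Rightarrow> 'a set"
  for f :: "'a \<Rightarrow> 'a \<Rightarrow> 'a" and A :: "'a set" where
  base: "a \<in> A \<Longrightarrow> a \<in> gen f A"
| mult: "a \<in> gen f A \<Longrightarrow> b \<in> gen f A \<Longrightarrow> f a b \<in> gen f A"

definition idempotents :: "('a \<Rightarrow> 'a \<Rightarrow> 'a) \<Rightarrow> 'a set \<Rightarrow> 'a set" where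
  "idempotents f T = {e \<in> T. f e e = e}"

definition idem_gen :: "('a \<Rightarrow> 'a \<Rightarrow> 'a) \<Rightarrow> 'a set \<Rightarrow> 'a set" where
  "idem_gen f T = gen f (idempotents f T)"

text \<open>The next two are meaningful for finitely generated \<open>T\<close> (in particular finite \<open>T\<close>), respectively
  for \<open>T\<close> generated by finitely many idempotents; otherwise their value is unspecified.\<close>

definition sg_rank :: "('a \<Rightarrow> 'a \<Rightarrow> 'a) \<Rightarrow> 'a set \<Rightarrow> nat" where
  "sg_rank f T = (LEAST k. \<exists>A \<subseteq> T. finite A \<and> card A = k \<and> gen f A = T)"

definition sg_idrank :: "('a \<Rightarrow> 'a \<Rightarrow> 'a) \<Rightarrow> 'a set \<Rightarrow> nat" where
  "sg_idrank f T = (LEAST k. \<exists>A \<subseteq> idempotents f T. finite A \<and> card A = k \<and> gen f A = T)"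

lemma gen_idempotents_idem_gen: "gen f (idempotents f (idem_gen f T)) = idem_gen f T"
proof
  show "gen f (idempotents f (idem_gen f T)) \<subseteq> idem_gen f T"
  proof
    fix x assume "x \<in> gen f (idempotents f (idem_gen f T))"
    then show "x \<in> idem_gen f T"
      by induction (auto simp: idempotents_def idem_gen_def intro: gen.mult)
  qed
  show "idem_gen f T \<subseteq> gen f (idempotents f (idem_gen f T))"
  proof
    fix x assume "x \<in> idem_gen f T"
    then have "x \<in> gen f (idempotents f T)" by (simp add: idem_gen_def)
    then show "x \<in> gen f (idempotents f (idem_gen f T))"
    proof induction
      case (base a)
      then have "a \<in> idem_gen f T" by (simp add: idem_gen_def gen.base)
      with base show ?case by (intro gen.base) (simp add: idempotents_def)
    qed (rule gen.mult)
  qed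
qed

section \<open>Brauer partitions\<close>

text \<open>\<open>Plain x\<close>, \<open>Prime x\<close> and \<open>DPrime x\<close> stand for $x$, $x'$ and $x''$.\<close>

datatype vertex = Plain nat | Prime nat | DPrime nat

definition verts :: "nat \<Rightarrow> nat \<Rightarrow> vertex set" where
  "verts m n = Plain ` {1..m} \<union> Prime ` {1..n}"

type_synonym partition = "vertex set set"

definition brauer :: "nat \<Rightarrow> nat \<Rightarrow> partition set" where
  "brauer m n = {\<alpha>. partition_on (verts m n) \<alpha> \<and> (\<forall>B\<in>\<alpha>. card B = 2)}"

fun lower_vertex :: "vertex \<Rightarrow> vertex" where
  "lower_vertex (Prime x) = DPrime x"
| "lower_vertex v = v"

fun raise_vertex :: "vertex \<Rightarrow> vertex" where
  "raise_vertex (Plain x) = DPrime x"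
| "raise_vertex v = v"

text \<open>The edge relation of the product graph, every block of either (renamed) partition being
  represented by the complete graph, with loops, on its elements.\<close>

definition product_graph :: "partition \<Rightarrow> partition \<Rightarrow> (vertex \<times> vertex) set" where
  "product_graph \<alpha> \<beta> =
     (\<Union>B\<in>\<alpha>. (lower_vertex ` B) \<times> (lower_vertex ` B)) \<union>
     (\<Union>B\<in>\<beta>. (raise_vertex ` B) \<times> (raise_vertex ` B))"

text \<open>For \<open>\<alpha> \<in> brauer m n\<close> and \<open>\<beta> \<in> brauer n k\<close>; the blocks are the non-empty traces on
  \<open>verts m k\<close> of the connected components of the product graph.\<close>

definition pprod :: "nat \<Rightarrow> nat \<Rightarrow> partition \<Rightarrow> partition \<Rightarrow> partition" where
  "pprod m k \<alpha> \<beta> =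
     verts m k // {(x, y). x \<in> verts m k \<and> y \<in> verts m k \<and> (x, y) \<in> (product_graph \<alpha> \<beta>)\<^sup>*}"

definition prank :: "partition \<Rightarrow> nat" where
  "prank \<alpha> = card {B \<in> \<alpha>. B \<inter> range Plain \<noteq> {} \<and> B \<inter> range Prime \<noteq> {}}"

text \<open>The operation $\alpha \star_\sigma \beta = \alpha\sigma\beta$ on \<open>brauer m n\<close>, for
  \<open>\<sigma> \<in> brauer n m\<close>; here $\alpha\sigma$ lies in \<open>brauer m m\<close>.\<close>

definition sandwich :: "nat \<Rightarrow> nat \<Rightarrow> partition \<Rightarrow> partition \<Rightarrow> partition \<Rightarrow> partition" where
  "sandwich m n \<sigma> \<alpha> \<beta> = pprod m n (pprod m m \<alpha> \<sigma>) \<beta>"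

end

theory Submission
  imports Defs "HOL-Combinatorics.Permutations"
begin

text \<open>
  Diagrams are considered between arbitrary finite sets of naturals, so that \<open>\<sigma>\<close> factors as
  \<open>\<kappa> \<bullet> \<rho>\<close> through the set \<open>C\<close> of lower ends of its transversals, where \<open>card C = r\<close>, \<open>\<kappa>\<close> has no lower
  hooks and \<open>\<rho>\<close> no upper hooks. Let \<open>R\<close> be the set of right inverses of \<open>\<rho>\<close> and \<open>L\<close> the set of left
  inverses of \<open>\<kappa>\<close>. In the sandwich semigroup \<open>(a s b) \<star> (c t d) = a (s t) d\<close> for \<open>a, c \<in> R\<close>,
  \<open>b, d \<in> L\<close> and diagrams \<open>s, t\<close> on \<open>C\<close>, and the idempotents generate exactly the elements \<open>a s b\<close>
  for which \<open>s\<close> is the identity or has a hook. The elements \<open>a 1 b\<close> form a rectangular band, which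
  needs \<open>card R \<ge> card L\<close> generators; the remaining ones are generated with one element for each of
  the \<open>r choose 2\<close> upper hooks, because the diagrams on \<open>C\<close> that have a hook are generated by the
  projections with a single upper hook. Finally \<open>card R\<close> is found by removing the lower hooks of
  \<open>\<rho>\<close> one at a time: the fibres of left multiplication by a single cap all have the same size.
\<close>

section \<open>Perfect matchings\<close>

text \<open>Products are defined by connectivity, so even that their blocks are pairs needs an
  argument: a component in the superposition of two matchings is a path or a cycle, and only ends of
  paths lie in the outer rows. This is isolated for matchings of arbitrary sets and yields closure,
  the blocks of a product and associativity. An idempotent \<open>e\<close> equals
  \<open>(e \<bullet> \<kappa>) \<bullet> (\<rho> \<bullet> e)\<close>. So \<rho> creates no lower
  hook that \<open>e\<close> lacks, and \<open>e\<close> is recovered from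
  \<open>\<rho> \<bullet> e\<close> by some right inverse of \<rho>; dually for \<kappa>. The middle
  coordinate of \<open>e\<close> is then idempotent, and without hooks it cancels to the identity.
  For the lower bound a factorisation is read from the left. The first generator of
  \<open>a 1 b\<close> already has the coordinate \<open>a\<close>, and for an element with a single
  upper hook the first generator whose middle part is not the identity has exactly this hook. The
  two kinds of generators are disjoint, so the numbers add up. The condition
  \<open>m \<ge> n\<close> enters as \<open>card L \<le> card R\<close>: a surjection from
  \<open>R\<close> to \<open>L\<close> lets one idempotent per right inverse reach every left
  inverse.\<close>

definition matching :: "'a set \<Rightarrow> 'a set set \<Rightarrow> bool" where
  "matching V M \<longleftrightarrow> partition_on V M \<and> (\<forall>B\<in>M. card B = 2)"

definition adj :: "'a set set \<Rightarrow> ('a \<times> 'a) set" where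
  "adj M = {(u, v). {u, v} \<in> M}"

lemma matchingI:
  assumes "\<And>B. B \<in> M \<Longrightarrow> \<exists>u v. u \<noteq> v \<and> B = {u, v}"
    and "\<Union>M = V"
    and "\<And>u v w. {u, v} \<in> M \<Longrightarrow> {u, w} \<in> M \<Longrightarrow> v = w"
  shows "matching V M"
proof -
  have "disjoint M"
  proof (rule disjointI)
    fix A B assume *: "A \<in> M" "B \<in> M" "A \<noteq> B"
    show "A \<inter> B = {}"
    proof (rule ccontr)
      assume "A \<inter> B \<noteq> {}"
      then obtain x where x: "x \<in> A" "x \<in> B" by blast
      obtain v where "A = {x, v}" using assms(1)[OF *(1)] x by (auto simp: insert_commute)
      moreover obtain w where "B = {x, w}" using assms(1)[OF *(2)] x by (auto simp: insert_commute)
      ultimately show False using * assms(3) by blast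
    qed
  qed
  moreover have "card B = 2" if "B \<in> M" for B using assms(1)[OF that] by (auto simp: card_2_iff)
  moreover from this have "{} \<notin> M" by force
  ultimately show ?thesis
    using assms(2) by (simp add: matching_def partition_on_def)
qed

lemma matching_blockE:
  assumes "matching V M" "B \<in> M"
  obtains u v where "u \<noteq> v" "B = {u, v}"
  using assms by (auto simp: matching_def card_2_iff intro: that)

lemma matching_block: "matching V M \<Longrightarrow> B \<in> M \<Longrightarrow> \<exists>u v. u \<noteq> v \<and> B = {u, v}"
  by (metis matching_blockE)

lemma matching_Union: "matching V M \<Longrightarrow> \<Union>M = V"
  by (simp add: matching_def partition_on_def)

lemma matching_unique:
  assumes "matching V M" "{u, v} \<in> M" "{u, w} \<in> M"
  shows "v = w"
proof -
  have "{u, v} = {u, w}"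
    using assms disjointD[of M "{u, v}" "{u, w}"] by (auto simp: matching_def partition_on_def)
  then show ?thesis by (auto simp: doubleton_eq_iff)
qed

lemma matching_iff:
  assumes "matching V M" "{u, v} \<in> M"
  shows "{u, w} \<in> M \<longleftrightarrow> w = v" "{w, u} \<in> M \<longleftrightarrow> w = v"
    "{v, w} \<in> M \<longleftrightarrow> w = u" "{w, v} \<in> M \<longleftrightarrow> w = u"
  using matching_unique[OF assms(1), of u v w] matching_unique[OF assms(1), of v u w] assms(2)
  by (auto simp: insert_commute)

lemma matching_neq: "matching V M \<Longrightarrow> {u, v} \<in> M \<Longrightarrow> u \<noteq> v"
  by (auto simp: matching_def)

lemma matching_block_eq:
  assumes "matching V M" "B \<in> M" "u \<in> B" "{u, v} \<in> M"
  shows "B = {u, v}"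
  using assms disjointD[of M B "{u, v}"] by (auto simp: matching_def partition_on_def)

lemma matching_mem: "matching V M \<Longrightarrow> {u, v} \<in> M \<Longrightarrow> u \<in> V \<and> v \<in> V"
  using matching_Union by blast

lemma matching_partner:
  assumes "matching V M" "u \<in> V"
  obtains v where "{u, v} \<in> M" "u \<noteq> v"
proof -
  obtain B where B: "B \<in> M" "u \<in> B" using assms matching_Union by blast
  then obtain v where "B = {u, v}" "u \<noteq> v"
    using matching_blockE[OF assms(1) B(1)] by (metis insert_commute insertE singletonD)
  then show ?thesis using that B by blast
qed

text \<open>Every vertex of \<open>V\<close> already has a partner in \<open>M\<close>, and this
  must also be its partner in \<open>N\<close>; so one inclusion forces the other.\<close>

lemma matching_eqI:
  assumes "matching V M" "matching V N" "\<And>u v. {u, v} \<in> M \<Longrightarrow> {u, v} \<in> N"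
  shows "M = N"
proof
  show "M \<subseteq> N" using matching_block[OF assms(1)] assms(3) by blast
  show "N \<subseteq> M"
  proof
    fix B assume B: "B \<in> N"
    then obtain u v where uv: "B = {u, v}" using matching_block[OF assms(2)] by blast
    then have "u \<in> V" using B matching_mem[OF assms(2), of u v] by simp
    then obtain w where w: "{u, w} \<in> M" using matching_partner[OF assms(1)] by blast
    with assms(3) have "{u, w} \<in> N" by simp
    then have "w = v" using matching_unique[OF assms(2), of u w v] B uv by simp
    then show "B \<in> M" using w uv by simp
  qed
qed

lemma matching_pair: "u \<noteq> v \<Longrightarrow> matching {u, v} {{u, v}}"
  by (auto simp: matching_def partition_on_def)

lemma matching_Un:
  assumes "matching V M" "matching W N" "V \<inter> W = {}"
  shows "matching (V \<union> W) (M \<union> N)"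
proof (rule matchingI)
  show "\<exists>u v. u \<noteq> v \<and> B = {u, v}" if "B \<in> M \<union> N" for B
    using that matching_block assms(1,2) by (metis UnE)
  show "\<Union>(M \<union> N) = V \<union> W"
    using matching_Union[OF assms(1)] matching_Union[OF assms(2)] by simp
  show "b = c" if "{a, b} \<in> M \<union> N" "{a, c} \<in> M \<union> N" for a b c
  proof (cases "{a, b} \<in> M")
    case True
    then have "{a, c} \<notin> N"
      using matching_mem[OF assms(1), of a b] matching_mem[OF assms(2), of a c] assms(3) by auto
    then show ?thesis using True that matching_unique[OF assms(1), of a b c] by simp
  next
    case False
    then have "{a, c} \<notin> M"
      using that matching_mem[OF assms(2), of a b] matching_mem[OF assms(1), of a c] assms(3) by auto
    then show ?thesis using False that matching_unique[OF assms(2), of a b c] by simp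
  qed
qed

lemma matching_insert:
  assumes "matching V M" "u \<noteq> v" "u \<notin> V" "v \<notin> V"
  shows "matching (insert u (insert v V)) (insert {u, v} M)"
  using matching_Un[OF matching_pair[OF assms(2)] assms(1)] assms(3,4) by simp

lemma matching_remove:
  assumes "matching V M" "{u, v} \<in> M"
  shows "matching (V - {u, v}) (M - {{u, v}})"
proof (rule matchingI)
  show "\<exists>u v. u \<noteq> v \<and> B = {u, v}" if "B \<in> M - {{u, v}}" for B
    using that matching_block[OF assms(1), of B] by simp
  have "B \<inter> {u, v} = {}" if "B \<in> M - {{u, v}}" for B
    using that assms disjointD[of M B "{u, v}"] by (auto simp: matching_def partition_on_def)
  then show "\<Union>(M - {{u, v}}) = V - {u, v}"
    unfolding matching_Union[OF assms(1), symmetric] by blast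
  show "b = c" if "{a, b} \<in> M - {{u, v}}" "{a, c} \<in> M - {{u, v}}" for a b c
    using that matching_unique[OF assms(1), of a b c] by simp
qed

lemma matching_image:
  assumes "matching V M" "inj_on f V"
  shows "matching (f ` V) ((`) f ` M)"
proof (rule matchingI)
  fix B assume "B \<in> (`) f ` M"
  then obtain A where "A \<in> M" "B = f ` A" by blast
  then obtain u v where "{u, v} \<in> M" "u \<noteq> v" "B = {f u, f v}"
    by (metis matching_blockE[OF assms(1)] image_insert image_empty)
  then show "\<exists>u v. u \<noteq> v \<and> B = {u, v}"
    using matching_mem[OF assms(1)] assms(2) by (metis inj_onD)
next
  show "\<Union> ((`) f ` M) = f ` V"
    using matching_Union[OF assms(1)] by blast
next
  fix u v w assume "{u, v} \<in> (`) f ` M" "{u, w} \<in> (`) f ` M"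
  then obtain A B where AB: "A \<in> M" "B \<in> M" "{u, v} = f ` A" "{u, w} = f ` B" by blast
  from AB obtain a where a: "a \<in> A" "u = f a" by blast
  from AB obtain b where b: "b \<in> B" "u = f b" by blast
  have "a = b" using a b AB matching_Union[OF assms(1)] inj_onD[OF assms(2), of a b] by blast
  then have "A = B"
    using AB a b assms(1) disjointD[of M A B] by (auto simp: matching_def partition_on_def)
  then show "v = w" using AB by (metis doubleton_eq_iff)
qed

lemma finite_matching: "finite V \<Longrightarrow> matching V M \<Longrightarrow> finite M"
  using finite_elements by (auto simp: matching_def)

section \<open>Superposition of two matchings\<close>

lemma adj_iff [simp]: "(u, v) \<in> adj M \<longleftrightarrow> {u, v} \<in> M"
  by (simp add: adj_def)

text \<open>In the superposition of a matching of \<open>A\<close> and one of \<open>B\<close> these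
  are the vertices of degree one, the ends of the paths; those of \<open>A \<inter> B\<close> have
  degree two and get hidden.\<close>

definition symd :: "'a set \<Rightarrow> 'a set \<Rightarrow> 'a set" where
  "symd A B = (A - B) \<union> (B - A)"

lemma rtrancl_collapse:
  assumes "(u, v) \<in> G\<^sup>*" "\<And>a b. (a, b) \<in> G \<Longrightarrow> (g a, g b) \<in> H\<^sup>*"
  shows "(g u, g v) \<in> H\<^sup>*"
  using assms(1) by induction (auto intro: rtrancl_trans assms(2))

lemma matching_adj_rtrancl:
  assumes "matching V M" "(u, v) \<in> (adj M)\<^sup>*"
  shows "u = v \<or> {u, v} \<in> M"
  using assms(2)
proof induction
  case (step y z)
  then have "{y, z} \<in> M" by simp
  then show ?case
    using step.IH matching_unique[OF assms(1), of y u z] by (metis insert_commute)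
qed simp

lemma adj_subset:
  assumes "matching V M"
  shows "adj M \<subseteq> V \<times> V"
proof
  fix e assume "e \<in> adj M"
  then show "e \<in> V \<times> V" using matching_mem[OF assms, of "fst e" "snd e"]
    by (cases e) simp
qed

lemma adj_insert_subset:
  assumes "(u, v) \<in> R" "(v, u) \<in> R" "adj M \<subseteq> R"
  shows "adj (insert {u, v} M) \<subseteq> R"
proof -
  have "(a, b) \<in> R" if "{a, b} \<in> M" for a b using assms(3) that by (auto simp: adj_def)
  then show ?thesis using assms(1,2) by (auto simp: doubleton_eq_iff)
qed

text \<open>Adding one more edge \<open>{y, p}\<close> to a matching and hiding the vertices that have acquired degree 2
  again leaves a matching; superposing two matchings is done one edge at a time.\<close>

lemma matching_toggle:
  assumes M: "matching B M" and "y \<noteq> p"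
  obtains M' where "matching (symd B {y, p}) M'"
    "adj M' \<subseteq> (adj M \<union> {(y, p), (p, y)})\<^sup>*"
    "\<And>u v. u \<in> symd B {y, p} \<Longrightarrow> v \<in> symd B {y, p} \<Longrightarrow>
       (u, v) \<in> (adj M \<union> {(y, p), (p, y)})\<^sup>* \<Longrightarrow> u = v \<or> {u, v} \<in> M'"
proof -
  let ?G = "adj M \<union> {(y, p), (p, y)}"
  note result = that
  \<comment> \<open>\<open>g\<close> is a contraction that fixes the surviving vertices and turns
    every edge of the enlarged graph into a path of \<open>M'\<close>, so it carries connecting
    paths over to \<open>M'\<close>. The cases below differ only in the choice of \<open>M'\<close>
    and \<open>g\<close>.\<close>
  have main: thesis if "matching (symd B {y, p}) M'" "adj M' \<subseteq> ?G\<^sup>*"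
      "\<And>u. u \<in> symd B {y, p} \<Longrightarrow> g u = u"
      "\<And>a b. (a, b) \<in> ?G \<Longrightarrow> (g a, g b) \<in> (adj M')\<^sup>*" for M' g
    using that(1,2)
  proof (rule result)
    fix u v assume "u \<in> symd B {y, p}" "v \<in> symd B {y, p}" "(u, v) \<in> ?G\<^sup>*"
    then have "(u, v) \<in> (adj M')\<^sup>*"
      using rtrancl_collapse[of u v ?G g "adj M'"] that(3,4) by simp
    then show "u = v \<or> {u, v} \<in> M'" by (rule matching_adj_rtrancl[OF that(1)])
  qed
  \<comment> \<open>Exactly one end is matched: the path \<open>q\<close>, \<open>a\<close>,
    \<open>b\<close> shrinks to the edge \<open>{b, q}\<close>.\<close>
  have one: thesis if "a \<in> B" "b \<notin> B" "{a, b} = {y, p}" for a b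
  proof -
    obtain q where q: "{a, q} \<in> M" "a \<noteq> q" using matching_partner[OF M \<open>a \<in> B\<close>] .
    have qb: "q \<noteq> b" "q \<in> B" using q matching_mem[OF M] that by auto
    let ?M = "insert {b, q} (M - {{a, q}})"
    have ab: "{(y, p), (p, y)} = {(a, b), (b, a)}" using that(3) by (auto simp: doubleton_eq_iff)
    have eq: "symd B {y, p} = insert b (insert q (B - {a, q}))"
      using that q qb by (auto simp: symd_def that(3)[symmetric])
    show thesis
    proof (rule main)
      show "matching (symd B {y, p}) ?M"
        unfolding eq by (rule matching_insert[OF matching_remove[OF M q(1)]]) (use that qb in auto)
      have "(b, a) \<in> ?G\<^sup>*" "(a, b) \<in> ?G\<^sup>*" "(a, q) \<in> ?G\<^sup>*" "(q, a) \<in> ?G\<^sup>*"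
        unfolding ab using q by (auto simp: insert_commute)
      then have "(b, q) \<in> ?G\<^sup>*" "(q, b) \<in> ?G\<^sup>*" by (meson rtrancl_trans)+
      then show "adj ?M \<subseteq> ?G\<^sup>*" by (rule adj_insert_subset) auto
      show "(id(a := b)) u = u" if "u \<in> symd B {y, p}" for u
        using that \<open>a \<in> B\<close> \<open>b \<notin> B\<close> \<open>a \<noteq> q\<close> unfolding eq by auto
      have sym: "(q, b) \<in> (adj ?M)\<^sup>*" by (rule r_into_rtrancl) (simp add: insert_commute)
      show "((id(a := b)) c, (id(a := b)) d) \<in> (adj ?M)\<^sup>*" if "(c, d) \<in> ?G" for c d
      proof (cases "c = a \<or> d = a")
        case True
        then have "(c = a \<and> (d = q \<or> d = b)) \<or> (d = a \<and> (c = q \<or> c = b))"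
          using that matching_iff[OF M q(1)] unfolding ab by auto
        then show ?thesis using sym q(2) qb \<open>a \<in> B\<close> \<open>b \<notin> B\<close> by auto
      next
        case False
        then have "{c, d} \<in> ?M" using that unfolding ab by (auto simp: doubleton_eq_iff)
        then have "(c, d) \<in> (adj ?M)\<^sup>*" by (intro r_into_rtrancl) simp
        then show ?thesis using False by simp
      qed
    qed
  qed
  consider "y \<in> B" "p \<notin> B" | "p \<in> B" "y \<notin> B" | "y \<notin> B" "p \<notin> B" | "{y, p} \<in> M"
    | "y \<in> B" "p \<in> B" "{y, p} \<notin> M" by blast
  then show thesis
  proof cases
    case 1 then show ?thesis by (rule one) simp
  next
    case 2 then show ?thesis by (rule one) (simp add: insert_commute)
  next
    case 3
    then have eq: "symd B {y, p} = insert y (insert p B)" by (auto simp: symd_def)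
    show ?thesis
    proof (rule main)
      show "matching (symd B {y, p}) (insert {y, p} M)"
        unfolding eq using 3 by (intro matching_insert[OF M assms(2)])
    qed (auto simp: doubleton_eq_iff insert_commute)
  next
    \<comment> \<open>The new edge doubles an old one: the closed loop disappears with both its
      vertices, which are simply identified.\<close>
    case 4
    then have "y \<in> B" "p \<in> B" using matching_mem[OF M] by auto
    then have eq: "symd B {y, p} = B - {y, p}" by (auto simp: symd_def)
    show ?thesis
    proof (rule main)
      show "matching (symd B {y, p}) (M - {{y, p}})"
        unfolding eq by (rule matching_remove[OF M 4])
      show "adj (M - {{y, p}}) \<subseteq> ?G\<^sup>*" by auto
      show "(id(p := y)) u = u" if "u \<in> symd B {y, p}" for u using that eq by auto
      show "((id(p := y)) c, (id(p := y)) d) \<in> (adj (M - {{y, p}}))\<^sup>*" if "(c, d) \<in> ?G" for c d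
      proof (cases "c \<in> {y, p} \<or> d \<in> {y, p}")
        case True
        then have "c \<in> {y, p} \<and> d \<in> {y, p}"
          using that matching_iff[OF M 4] by auto
        then show ?thesis by auto
      next
        case False
        then have "{c, d} \<in> M - {{y, p}}" using that by (auto simp: doubleton_eq_iff)
        then have "(c, d) \<in> (adj (M - {{y, p}}))\<^sup>*" by (intro r_into_rtrancl) simp
        then show ?thesis using False by simp
      qed
    qed
  next
    \<comment> \<open>Both ends are matched elsewhere: the path \<open>q\<close>, \<open>y\<close>,
      \<open>p\<close>, \<open>s\<close> shrinks to the edge \<open>{q, s}\<close>.\<close>
    case 5
    obtain q where q: "{y, q} \<in> M" "y \<noteq> q" using matching_partner[OF M \<open>y \<in> B\<close>] .
    obtain s where s: "{p, s} \<in> M" "p \<noteq> s" using matching_partner[OF M \<open>p \<in> B\<close>] .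
    have d: "q \<noteq> p" "s \<noteq> y" using 5 q s by (auto simp: insert_commute)
    have qs: "q \<noteq> s" using matching_iff[OF M q(1)] s assms(2) by auto
    have B: "q \<in> B" "s \<in> B" using q s matching_mem[OF M] by auto
    let ?M = "insert {q, s} (M - {{y, q}} - {{p, s}})"
    have eq: "symd B {y, p} = insert q (insert s (B - {y, q} - {p, s}))"
      using 5 B d qs q s by (auto simp: symd_def)
    let ?g = "id(y := q, p := s)"
    show ?thesis
    proof (rule main)
      show "matching (symd B {y, p}) ?M"
        unfolding eq
        by (rule matching_insert[OF matching_remove[OF matching_remove[OF M q(1)]]])
           (use qs d s assms in \<open>auto simp: doubleton_eq_iff\<close>)
      have "(q, y) \<in> ?G\<^sup>*" "(y, p) \<in> ?G\<^sup>*" "(p, s) \<in> ?G\<^sup>*" "(s, p) \<in> ?G\<^sup>*" "(p, y) \<in> ?G\<^sup>*" "(y, q) \<in> ?G\<^sup>*"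
        using q s by (auto simp: insert_commute)
      then have "(q, s) \<in> ?G\<^sup>*" "(s, q) \<in> ?G\<^sup>*" by (meson rtrancl_trans)+
      then show "adj ?M \<subseteq> ?G\<^sup>*" by (rule adj_insert_subset) auto
      show "?g u = u" if "u \<in> symd B {y, p}" for u
        using that 5 by (auto simp: symd_def)
      have sym: "(q, s) \<in> (adj ?M)\<^sup>*" "(s, q) \<in> (adj ?M)\<^sup>*"
        by (auto intro!: r_into_rtrancl simp: insert_commute)
      show "(?g c, ?g d) \<in> (adj ?M)\<^sup>*" if "(c, d) \<in> ?G" for c d
      proof (cases "c \<in> {y, p} \<or> d \<in> {y, p}")
        case True
        then have "(c = y \<and> d = q) \<or> (c = q \<and> d = y) \<or> (c = p \<and> d = s) \<or> (c = s \<and> d = p)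
            \<or> (c = y \<and> d = p) \<or> (c = p \<and> d = y)"
          using that matching_iff[OF M q(1)] matching_iff[OF M s(1)] by auto
        then show ?thesis using sym d q s assms by auto
      next
        case False
        then have "{c, d} \<in> ?M" using that by (auto simp: doubleton_eq_iff)
        then have "(c, d) \<in> (adj ?M)\<^sup>*" by (intro r_into_rtrancl) simp
        then show ?thesis using False by simp
      qed
    qed
  qed
qed

text \<open>Since \<open>G\<^sub>2\<close> never leaves \<open>S\<close>, a path between points of
  \<open>S\<close> consists of edges of \<open>G\<^sub>2\<close> and of excursions in
  \<open>G\<^sub>1\<close> that start and end in \<open>S\<close>. This lets hidden vertices be
  eliminated in stages.\<close>

lemma rtrancl_trace:
  assumes "G\<^sub>2 \<subseteq> S \<times> S" "x \<in> S" "y \<in> S" "(x, y) \<in> (G\<^sub>1 \<union> G\<^sub>2)\<^sup>*"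
  shows "(x, y) \<in> ((G\<^sub>1\<^sup>* \<inter> S \<times> S) \<union> G\<^sub>2)\<^sup>*"
proof -
  let ?H = "(G\<^sub>1\<^sup>* \<inter> S \<times> S) \<union> G\<^sub>2"
  have "\<exists>z\<in>S. (x, z) \<in> ?H\<^sup>* \<and> (z, y) \<in> G\<^sub>1\<^sup>*"
    using assms(4)
  proof induction
    case base
    then show ?case using assms(2) by blast
  next
    case (step y w)
    then obtain z where z: "z \<in> S" "(x, z) \<in> ?H\<^sup>*" "(z, y) \<in> G\<^sub>1\<^sup>*" by blast
    show ?case
    proof (cases "(y, w) \<in> G\<^sub>1")
      case True
      then show ?thesis using z by (meson rtrancl.rtrancl_into_rtrancl)
    next
      case False
      then have yw: "(y, w) \<in> G\<^sub>2" using step by blast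
      then have "y \<in> S" "w \<in> S" using assms(1) by auto
      then have "(z, y) \<in> ?H" using z by blast
      then have "(x, w) \<in> ?H\<^sup>*" using z(2) yw by (meson UnI2 rtrancl.rtrancl_into_rtrancl)
      then show ?thesis using \<open>w \<in> S\<close> by blast
    qed
  qed
  then obtain z where "z \<in> S" "(x, z) \<in> ?H\<^sup>*" "(z, y) \<in> G\<^sub>1\<^sup>*" by blast
  then have "(z, y) \<in> ?H" using assms(3) by blast
  with \<open>(x, z) \<in> ?H\<^sup>*\<close> show ?thesis by (meson rtrancl.rtrancl_into_rtrancl)
qed

text \<open>Induction over the edges of \<open>M\<^sub>1\<close>: each is toggled into
  \<open>M\<^sub>2\<close>, whose vertex set therefore has to vary. The last two conclusions
  together say that connectivity of distinct visible vertices is exactly \<open>M\<close>.\<close>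

lemma matching_superpose:
  assumes "finite M\<^sub>1" "matching A M\<^sub>1" "matching B M\<^sub>2"
  obtains M where "matching (symd A B) M" "adj M \<subseteq> (adj M\<^sub>1 \<union> adj M\<^sub>2)\<^sup>*"
    "\<And>u v. u \<in> symd A B \<Longrightarrow> v \<in> symd A B \<Longrightarrow>
       (u, v) \<in> (adj M\<^sub>1 \<union> adj M\<^sub>2)\<^sup>* \<Longrightarrow> u = v \<or> {u, v} \<in> M"
proof -
  have "\<exists>M. matching (symd A B) M \<and> adj M \<subseteq> (adj M\<^sub>1 \<union> adj M\<^sub>2)\<^sup>* \<and>
     (\<forall>u\<in>symd A B. \<forall>v\<in>symd A B. (u, v) \<in> (adj M\<^sub>1 \<union> adj M\<^sub>2)\<^sup>* \<longrightarrow> u = v \<or> {u, v} \<in> M)"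
    using assms
  proof (induction arbitrary: A B M\<^sub>2)
    case empty
    then have "A = {}" using matching_Union by blast
    then have "symd A B = B" by (simp add: symd_def)
    moreover have "adj {} \<union> adj M\<^sub>2 = adj M\<^sub>2" by (auto simp: adj_def)
    ultimately show ?case using matching_adj_rtrancl[OF empty(2)] empty(2) by (auto intro!: exI[of _ M\<^sub>2])
  next
    case (insert e M\<^sub>1)
    obtain y p where yp: "y \<noteq> p" "e = {y, p}" using matching_blockE[OF insert.prems(1)] by blast
    let ?A = "A - {y, p}" and ?B = "symd B {y, p}" and ?G = "adj M\<^sub>2 \<union> {(y, p), (p, y)}"
    have ypA: "y \<in> A" "p \<in> A" using yp matching_mem[OF insert.prems(1)] by auto
    have m1: "matching ?A M\<^sub>1"
      using matching_remove[OF insert.prems(1), of y p] yp insert.hyps by simp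
    obtain M' where M': "matching ?B M'" "adj M' \<subseteq> ?G\<^sup>*"
      "\<And>u v. u \<in> ?B \<Longrightarrow> v \<in> ?B \<Longrightarrow> (u, v) \<in> ?G\<^sup>* \<Longrightarrow> u = v \<or> {u, v} \<in> M'"
      by (rule matching_toggle[OF insert.prems(2) yp(1)]) (blast intro: that)
    \<comment> \<open>Moving \<open>e\<close> from the first matching to the second toggles its two
      ends on both sides, which cancels in the symmetric difference.\<close>
    have AB: "symd ?A ?B = symd A B" using ypA by (auto simp: symd_def)
    obtain M where M: "matching (symd A B) M" "adj M \<subseteq> (adj M\<^sub>1 \<union> adj M')\<^sup>*"
      "\<forall>u\<in>symd A B. \<forall>v\<in>symd A B. (u, v) \<in> (adj M\<^sub>1 \<union> adj M')\<^sup>* \<longrightarrow> u = v \<or> {u, v} \<in> M"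
      using insert.IH[OF m1 M'(1)] AB by auto
    have G: "adj (insert e M\<^sub>1) \<union> adj M\<^sub>2 = ?G \<union> adj M\<^sub>1"
      using yp by (auto simp: doubleton_eq_iff)
    have "adj M\<^sub>1 \<union> adj M' \<subseteq> (?G \<union> adj M\<^sub>1)\<^sup>*"
      using M'(2) rtrancl_mono[of ?G "?G \<union> adj M\<^sub>1"] by auto
    then have "adj M \<subseteq> (adj (insert e M\<^sub>1) \<union> adj M\<^sub>2)\<^sup>*"
      unfolding G using M(2) rtrancl_subset_rtrancl by blast
    moreover have "u = v \<or> {u, v} \<in> M"
      if uv: "u \<in> symd A B" "v \<in> symd A B" "(u, v) \<in> (?G \<union> adj M\<^sub>1)\<^sup>*" for u v
    proof -
      \<comment> \<open>The vertices missing from \<open>?S\<close> are ends of \<open>e\<close>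
        hidden by the toggle. Only edges of \<open>?G\<close> meet them, so \<open>?G\<close> is the
        relation to be replaced by its trace.\<close>
      let ?S = "?A \<union> ?B"
      have "u \<in> ?S" "v \<in> ?S" using uv AB by (auto simp: symd_def)
      moreover have "adj M\<^sub>1 \<subseteq> ?S \<times> ?S" using adj_subset[OF m1] by blast
      ultimately have *: "(u, v) \<in> ((?G\<^sup>* \<inter> ?S \<times> ?S) \<union> adj M\<^sub>1)\<^sup>*"
        using uv(3) by (intro rtrancl_trace)
      have GF: "?G \<subseteq> (B \<union> {y, p}) \<times> (B \<union> {y, p})"
        using adj_subset[OF insert.prems(2)] by blast
      have "?G\<^sup>* \<inter> ?S \<times> ?S \<subseteq> (adj M\<^sub>1 \<union> adj M')\<^sup>*"
      proof
        fix z assume z: "z \<in> ?G\<^sup>* \<inter> ?S \<times> ?S"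
        obtain a b where ab: "z = (a, b)" by force
        have "a = b \<or> {a, b} \<in> M'"
        proof (cases "a = b")
          case False
          then have "(a, b) \<in> ?G\<^sup>+" using z ab by (auto simp: rtrancl_eq_or_trancl)
          then have "(a, b) \<in> (B \<union> {y, p}) \<times> (B \<union> {y, p})"
            using trancl_subset_Sigma[OF GF] by blast
          then have "a \<in> ?B" "b \<in> ?B" using z ab by (auto simp: symd_def)
          then show ?thesis using M'(3) z ab by auto
        qed simp
        then show "z \<in> (adj M\<^sub>1 \<union> adj M')\<^sup>*" using ab by auto
      qed
      then have "(u, v) \<in> (adj M\<^sub>1 \<union> adj M')\<^sup>*"
        using * rtrancl_subset_rtrancl[of "(?G\<^sup>* \<inter> ?S \<times> ?S) \<union> adj M\<^sub>1" "adj M\<^sub>1 \<union> adj M'"] by blast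
      then show ?thesis using M(3) uv by blast
    qed
    ultimately show ?case using M(1) unfolding G by blast
  qed
  then show thesis using that by blast
qed

section \<open>The category of Brauer diagrams\<close>

definition pts :: "nat set \<Rightarrow> nat set \<Rightarrow> vertex set" where
  "pts X Y = Plain ` X \<union> Prime ` Y"

definition diag :: "nat set \<Rightarrow> nat set \<Rightarrow> partition set" where
  "diag X Y = {\<alpha>. finite X \<and> finite Y \<and> matching (pts X Y) \<alpha>}"

text \<open>Agrees with \<open>pprod\<close>; the outer vertex sets are read off the two diagrams.\<close>

definition diagram_comp :: "partition \<Rightarrow> partition \<Rightarrow> partition"  (infixl "\<bullet>" 70) where
  "\<alpha> \<bullet> \<beta> = (let V = pts {x. Plain x \<in> \<Union>\<alpha>} {z. Prime z \<in> \<Union>\<beta>}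
     in V // {(x, y). x \<in> V \<and> y \<in> V \<and> (x, y) \<in> (product_graph \<alpha> \<beta>)\<^sup>*})"

definition con :: "partition \<Rightarrow> partition \<Rightarrow> vertex \<Rightarrow> vertex \<Rightarrow> bool" where
  "con \<alpha> \<beta> u v \<longleftrightarrow> (u, v) \<in> (product_graph \<alpha> \<beta>)\<^sup>*"

lemma pts_simps [simp]:
  "Plain x \<in> pts X Y \<longleftrightarrow> x \<in> X" "Prime x \<in> pts X Y \<longleftrightarrow> x \<in> Y" "DPrime x \<notin> pts X Y"
  by (auto simp: pts_def)

lemma ptsE:
  assumes "u \<in> pts X Y"
  obtains x where "u = Plain x" "x \<in> X" | y where "u = Prime y" "y \<in> Y"
  using assms by (auto simp: pts_def)

lemma diag_matching: "\<alpha> \<in> diag X Y \<Longrightarrow> matching (pts X Y) \<alpha>"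
  and diag_finite: "\<alpha> \<in> diag X Y \<Longrightarrow> finite X" "\<alpha> \<in> diag X Y \<Longrightarrow> finite Y"
  by (auto simp: diag_def)

lemma finite_diag: "finite (diag X Y)"
proof -
  have "diag X Y \<subseteq> Pow (Pow (pts X Y))"
    using matching_Union by (auto simp: diag_def)
  then show ?thesis
    by (cases "finite X \<and> finite Y") (auto simp: diag_def pts_def intro: finite_subset)
qed

lemma brauer_diag: "brauer m n = diag {1..m} {1..n}"
  by (auto simp: brauer_def diag_def matching_def pts_def verts_def)

lemma diag_Union:
  assumes "\<alpha> \<in> diag X Y"
  shows "Plain x \<in> \<Union>\<alpha> \<longleftrightarrow> x \<in> X" "Prime x \<in> \<Union>\<alpha> \<longleftrightarrow> x \<in> Y"
  using matching_Union[OF diag_matching[OF assms]] by simp_all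

lemma comp_eq:
  assumes "\<alpha> \<in> diag X Y" "\<beta> \<in> diag Y Z"
  shows "\<alpha> \<bullet> \<beta> = pts X Z // {(x, y). x \<in> pts X Z \<and> y \<in> pts X Z \<and> con \<alpha> \<beta> x y}"
  using diag_Union[OF assms(1)] diag_Union[OF assms(2)] by (simp add: diagram_comp_def con_def Let_def)

lemma pprod_comp:
  assumes "\<alpha> \<in> diag {1..m} Y" "\<beta> \<in> diag Y {1..k}"
  shows "pprod m k \<alpha> \<beta> = \<alpha> \<bullet> \<beta>"
  using comp_eq[OF assms] by (simp add: pprod_def con_def verts_def pts_def)

lemma con_refl [simp]: "con \<alpha> \<beta> u u"
  by (simp add: con_def)

lemma con_trans [trans]: "con \<alpha> \<beta> u v \<Longrightarrow> con \<alpha> \<beta> v w \<Longrightarrow> con \<alpha> \<beta> u w"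
  unfolding con_def by (rule rtrancl_trans)

lemma con_sym: "con \<alpha> \<beta> u v \<Longrightarrow> con \<alpha> \<beta> v u"
proof -
  have "sym (product_graph \<alpha> \<beta>)" by (auto simp: sym_def product_graph_def)
  then show "con \<alpha> \<beta> u v \<Longrightarrow> con \<alpha> \<beta> v u"
    unfolding con_def by (meson sym_rtrancl symD)
qed

lemma con_lower: "{u, v} \<in> \<alpha> \<Longrightarrow> con \<alpha> \<beta> (lower_vertex u) (lower_vertex v)"
  unfolding con_def product_graph_def by (rule r_into_rtrancl) blast

lemma con_raise: "{u, v} \<in> \<beta> \<Longrightarrow> con \<alpha> \<beta> (raise_vertex u) (raise_vertex v)"
  unfolding con_def product_graph_def by (rule r_into_rtrancl) blast

text \<open>Complete graphs with loops on pairs and the bare edges of the matchings have the same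
  reflexive transitive closure; this makes \<open>matching_superpose\<close> applicable.\<close>

lemma con_adj:
  assumes "matching V \<alpha>" "matching W \<beta>"
  shows "con \<alpha> \<beta> u v \<longleftrightarrow>
    (u, v) \<in> (adj ((`) lower_vertex ` \<alpha>) \<union> adj ((`) raise_vertex ` \<beta>))\<^sup>*"
proof -
  let ?H = "adj ((`) lower_vertex ` \<alpha>) \<union> adj ((`) raise_vertex ` \<beta>)"
  have "(g a, g b) \<in> (adj ((`) g ` M))\<^sup>*" if *: "matching U M" "B \<in> M" "a \<in> B" "b \<in> B"
    for U M B a b and g :: "vertex \<Rightarrow> vertex"
  proof (cases "a = b")
    case False
    obtain x y where "B = {x, y}" using matching_block[OF *(1,2)] by blast
    then have "B = {a, b}" using * False by auto
    then have "{g a, g b} \<in> (`) g ` M" using *(2) by (auto intro!: image_eqI[of _ _ B])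
    then show ?thesis by (intro r_into_rtrancl) simp
  qed simp
  note * = this[OF assms(1)] this[OF assms(2)]
  have "(a, b) \<in> ?H\<^sup>*" if "(a, b) \<in> product_graph \<alpha> \<beta>" for a b
  proof -
    have "(\<exists>B\<in>\<alpha>. \<exists>c\<in>B. \<exists>d\<in>B. a = lower_vertex c \<and> b = lower_vertex d) \<or>
        (\<exists>B\<in>\<beta>. \<exists>c\<in>B. \<exists>d\<in>B. a = raise_vertex c \<and> b = raise_vertex d)"
      using that by (auto simp: product_graph_def)
    then have "(a, b) \<in> (adj ((`) lower_vertex ` \<alpha>))\<^sup>* \<or> (a, b) \<in> (adj ((`) raise_vertex ` \<beta>))\<^sup>*"
      using * by blast
    then show ?thesis
      using rtrancl_mono[of "adj ((`) lower_vertex ` \<alpha>)" ?H]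
        rtrancl_mono[of "adj ((`) raise_vertex ` \<beta>)" ?H] by blast
  qed
  then have "(product_graph \<alpha> \<beta>)\<^sup>* \<subseteq> ?H\<^sup>*"
    by (intro rtrancl_subset_rtrancl) auto
  moreover have "?H \<subseteq> product_graph \<alpha> \<beta>"
  proof
    fix e assume e: "e \<in> ?H"
    obtain a b where "e = (a, b)" by force
    with e have "(\<exists>B\<in>\<alpha>. {a, b} = lower_vertex ` B) \<or> (\<exists>B\<in>\<beta>. {a, b} = raise_vertex ` B)"
      by (auto simp: adj_def)
    then show "e \<in> product_graph \<alpha> \<beta>"
    proof (elim disjE bexE)
      fix B assume B: "{a, b} = lower_vertex ` B" "B \<in> \<alpha>"
      then have "a \<in> lower_vertex ` B" "b \<in> lower_vertex ` B" by auto
      then show ?thesis using B(2) \<open>e = (a, b)\<close> by (auto simp: product_graph_def)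
    next
      fix B assume B: "{a, b} = raise_vertex ` B" "B \<in> \<beta>"
      then have "a \<in> raise_vertex ` B" "b \<in> raise_vertex ` B" by auto
      then show ?thesis using B(2) \<open>e = (a, b)\<close> by (auto simp: product_graph_def)
    qed
  qed
  ultimately have "(product_graph \<alpha> \<beta>)\<^sup>* = ?H\<^sup>*"
    by (metis rtrancl_mono subset_antisym)
  then show ?thesis by (simp only: con_def)
qed

lemma matching_quotient:
  assumes "matching V M"
  shows "V // {(x, y). x \<in> V \<and> y \<in> V \<and> (x = y \<or> {x, y} \<in> M)} = M" (is "V // ?R = M")
proof -
  have cl: "?R `` {x} = {x, y}" if "{x, y} \<in> M" for x y
    using that matching_iff[OF assms that] matching_mem[OF assms that] by auto
  show ?thesis
  proof (intro subset_antisym subsetI)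
    fix B assume "B \<in> V // ?R"
    then obtain x where x: "x \<in> V" "B = ?R `` {x}" by (rule quotientE)
    obtain y where "{x, y} \<in> M" using matching_partner[OF assms x(1)] .
    then show "B \<in> M" using cl x(2) by simp
  next
    fix B assume B: "B \<in> M"
    obtain x y where xy: "B = {x, y}" using matching_block[OF assms B] by blast
    then have "x \<in> V" using B matching_mem[OF assms, of x y] by simp
    moreover have "B = ?R `` {x}" using cl[of x y] B xy by simp
    ultimately show "B \<in> V // ?R" using quotientI[of x V ?R] by simp
  qed
qed

lemma inj_lower: "inj_on lower_vertex (pts X Y)"
  and inj_raise: "inj_on raise_vertex (pts X Y)"
  by (auto simp: pts_def inj_on_def)

text \<open>The lowered \<alpha> and the raised \<beta> share exactly the middle row, so the
  vertices of degree one in their superposition are those of \<open>pts X Z\<close>.\<close>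

lemma
  assumes \<alpha>: "\<alpha> \<in> diag X Y" and \<beta>: "\<beta> \<in> diag Y Z"
  shows comp_diag: "\<alpha> \<bullet> \<beta> \<in> diag X Z"
    and comp_iff: "u \<in> pts X Z \<Longrightarrow> v \<in> pts X Z \<Longrightarrow> u \<noteq> v \<Longrightarrow> {u, v} \<in> \<alpha> \<bullet> \<beta> \<longleftrightarrow> con \<alpha> \<beta> u v"
proof -
  note m = diag_matching[OF \<alpha>] diag_matching[OF \<beta>]
  let ?A = "lower_vertex ` pts X Y" and ?B = "raise_vertex ` pts Y Z"
  let ?\<alpha> = "(`) lower_vertex ` \<alpha>" and ?\<beta> = "(`) raise_vertex ` \<beta>"
  have fin: "finite X" "finite Y" "finite Z" using diag_finite \<alpha> \<beta> by auto
  have "finite \<alpha>" using finite_matching[OF _ m(1)] fin by (simp add: pts_def)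
  then have f: "finite ?\<alpha>" by simp
  have mm: "matching ?A ?\<alpha>" "matching ?B ?\<beta>"
    using m by (auto intro: matching_image inj_lower inj_raise)
  have AB: "symd ?A ?B = pts X Z"
    by (auto simp: symd_def pts_def image_Un image_image)
  obtain M where M: "matching (pts X Z) M" "adj M \<subseteq> (adj ?\<alpha> \<union> adj ?\<beta>)\<^sup>*"
    "\<And>u v. u \<in> pts X Z \<Longrightarrow> v \<in> pts X Z \<Longrightarrow> (u, v) \<in> (adj ?\<alpha> \<union> adj ?\<beta>)\<^sup>* \<Longrightarrow> u = v \<or> {u, v} \<in> M"
    by (rule matching_superpose[OF f mm, unfolded AB]) (blast intro: that)
  have con: "con \<alpha> \<beta> u v \<longleftrightarrow> u = v \<or> {u, v} \<in> M" if "u \<in> pts X Z" "v \<in> pts X Z" for u v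
    using M(2,3) that unfolding con_adj[OF m] by (auto simp: adj_def)
  have eq: "\<alpha> \<bullet> \<beta> = M"
  proof -
    have "{(x, y). x \<in> pts X Z \<and> y \<in> pts X Z \<and> con \<alpha> \<beta> x y} =
        {(x, y). x \<in> pts X Z \<and> y \<in> pts X Z \<and> (x = y \<or> {x, y} \<in> M)}"
      using con by auto
    then show ?thesis
      unfolding comp_eq[OF assms] using matching_quotient[OF M(1)] by simp
  qed
  show "\<alpha> \<bullet> \<beta> \<in> diag X Z" using M(1) fin eq by (simp add: diag_def)
  show "{u, v} \<in> \<alpha> \<bullet> \<beta> \<longleftrightarrow> con \<alpha> \<beta> u v" if "u \<in> pts X Z" "v \<in> pts X Z" "u \<noteq> v"
    using con that eq by simp
qed

lemma comp_con:
  assumes "\<alpha> \<in> diag X Y" "\<beta> \<in> diag Y Z" "{u, v} \<in> \<alpha> \<bullet> \<beta>"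
  shows "con \<alpha> \<beta> u v"
proof -
  note m = diag_matching[OF comp_diag[OF assms(1,2)]]
  show ?thesis
    using comp_iff[OF assms(1,2)] matching_mem[OF m assms(3)] matching_neq[OF m assms(3)] assms(3)
    by blast
qed

text \<open>Only positive connectivity has to be checked, since both sides are known to be matchings of the same
  vertex set.\<close>

lemma comp_eqI:
  assumes "\<alpha> \<in> diag X Y" "\<beta> \<in> diag Y Z" "\<gamma> \<in> diag X Z"
    and "\<And>u v. {u, v} \<in> \<gamma> \<Longrightarrow> con \<alpha> \<beta> u v"
  shows "\<alpha> \<bullet> \<beta> = \<gamma>"
proof (rule sym, rule matching_eqI)
  note m = diag_matching[OF assms(3)]
  show "matching (pts X Z) \<gamma>" by (rule m)
  show "matching (pts X Z) (\<alpha> \<bullet> \<beta>)" by (rule diag_matching[OF comp_diag[OF assms(1,2)]])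
  show "{u, v} \<in> \<alpha> \<bullet> \<beta>" if "{u, v} \<in> \<gamma>" for u v
    using comp_iff[OF assms(1,2)] matching_mem[OF m that] matching_neq[OF m that] assms(4)[OF that]
    by blast
qed

text \<open>Drawing three diagrams on the layers 0, 1, 2, 3 makes both bracketings of their product the trace of
  one and the same superposition of matchings.\<close>

fun emb :: "nat \<Rightarrow> nat \<Rightarrow> nat \<Rightarrow> vertex \<Rightarrow> nat \<times> nat" where
  "emb i j k (Plain x) = (i, x)"
| "emb i j k (DPrime x) = (j, x)"
| "emb i j k (Prime x) = (k, x)"

definition lay :: "nat \<Rightarrow> nat \<Rightarrow> partition \<Rightarrow> (nat \<times> nat) set set" where
  "lay i j \<alpha> = (`) (emb i i j) ` \<alpha>"

lemma matching_lay:
  assumes "\<alpha> \<in> diag X Y" "i \<noteq> j"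
  shows "matching ({i} \<times> X \<union> {j} \<times> Y) (lay i j \<alpha>)"
proof -
  have "inj_on (emb i i j) (pts X Y)" using assms(2) by (auto simp: pts_def inj_on_def)
  moreover have "emb i i j ` pts X Y = {i} \<times> X \<union> {j} \<times> Y" by (force simp: pts_def)
  ultimately show ?thesis
    unfolding lay_def using matching_image[OF diag_matching[OF assms(1)], of "emb i i j"] by simp
qed

text \<open>Placing rows on layers \<open>i\<close>, \<open>j\<close>, \<open>k\<close> is
  compatible with the renaming of the middle row in the product, so paths of the product graph
  become paths between layers.\<close>

lemma con_lay:
  assumes "\<alpha> \<in> diag X Y" "\<beta> \<in> diag Y Z" "con \<alpha> \<beta> u v"
  shows "(emb i j k u, emb i j k v) \<in> (adj (lay i j \<alpha>) \<union> adj (lay j k \<beta>))\<^sup>*"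
proof -
  note m = diag_matching[OF assms(1)] diag_matching[OF assms(2)]
  have *: "(emb i j k a, emb i j k b) \<in> adj (lay i j \<alpha>)" if ab: "{a, b} \<in> (`) lower_vertex ` \<alpha>" for a b
  proof -
    obtain B where B: "B \<in> \<alpha>" "{a, b} = lower_vertex ` B" using ab by blast
    have "emb i j k (lower_vertex u) = emb i i j u" if "u \<in> B" for u
    proof -
      have "u \<in> pts X Y" using that B(1) matching_Union[OF m(1)] by blast
      then show ?thesis by (rule ptsE) auto
    qed
    then have "emb i j k ` {a, b} = emb i i j ` B" unfolding B(2) image_image by (rule image_cong[OF refl])
    then show ?thesis using B(1) by (auto simp: lay_def)
  qed
  have **: "(emb i j k a, emb i j k b) \<in> adj (lay j k \<beta>)" if ab: "{a, b} \<in> (`) raise_vertex ` \<beta>" for a b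
  proof -
    obtain B where B: "B \<in> \<beta>" "{a, b} = raise_vertex ` B" using ab by blast
    have "emb i j k (raise_vertex u) = emb j j k u" if "u \<in> B" for u
    proof -
      have "u \<in> pts Y Z" using that B(1) matching_Union[OF m(2)] by blast
      then show ?thesis by (rule ptsE) auto
    qed
    then have "emb i j k ` {a, b} = emb j j k ` B" unfolding B(2) image_image by (rule image_cong[OF refl])
    then show ?thesis using B(1) by (auto simp: lay_def)
  qed
  show ?thesis
    by (rule rtrancl_collapse[OF assms(3)[unfolded con_adj[OF m]]]) (use * ** in \<open>auto simp: adj_def\<close>)
qed

lemma adj_lay_comp:
  assumes "\<alpha> \<in> diag X Y" "\<beta> \<in> diag Y Z"
  shows "adj (lay i k (\<alpha> \<bullet> \<beta>)) \<subseteq> (adj (lay i j \<alpha>) \<union> adj (lay j k \<beta>))\<^sup>*"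
proof
  note m = diag_matching[OF comp_diag[OF assms]]
  fix e assume e: "e \<in> adj (lay i k (\<alpha> \<bullet> \<beta>))"
  obtain a b where ab: "e = (a, b)" by (cases e)
  obtain B where B: "B \<in> \<alpha> \<bullet> \<beta>" "{a, b} = emb i i k ` B" using e ab by (auto simp: lay_def)
  obtain u v where uv: "B = {u, v}" using matching_block[OF m B(1)] by blast
  have "w \<in> pts X Z \<Longrightarrow> emb i i k w = emb i j k w" for w by (erule ptsE) auto
  then have E: "emb i i k u = emb i j k u" "emb i i k v = emb i j k v"
    using matching_mem[OF m, of u v] B(1) uv by auto
  have "con \<alpha> \<beta> u v" "con \<alpha> \<beta> v u" using comp_con[OF assms] B(1) uv con_sym by blast+
  then have *: "(emb i j k u, emb i j k v) \<in> (adj (lay i j \<alpha>) \<union> adj (lay j k \<beta>))\<^sup>*"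
    "(emb i j k v, emb i j k u) \<in> (adj (lay i j \<alpha>) \<union> adj (lay j k \<beta>))\<^sup>*"
    using con_lay[OF assms] by blast+
  have "{a, b} = {emb i j k u, emb i j k v}" using B(2) uv E by simp
  then have "(a = emb i j k u \<and> b = emb i j k v) \<or> (a = emb i j k v \<and> b = emb i j k u)"
    by (auto simp: doubleton_eq_iff)
  then show "e \<in> (adj (lay i j \<alpha>) \<union> adj (lay j k \<beta>))\<^sup>*" using * ab by auto
qed

lemma comp_assoc:
  assumes \<alpha>: "\<alpha> \<in> diag X Y" and \<beta>: "\<beta> \<in> diag Y Z" and \<gamma>: "\<gamma> \<in> diag Z W"
  shows "\<alpha> \<bullet> \<beta> \<bullet> \<gamma> = \<alpha> \<bullet> (\<beta> \<bullet> \<gamma>)"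
proof -
  \<comment> \<open>The first and the third diagram occupy disjoint layers and form a single
    matching, so three diagrams need only one superposition.\<close>
  let ?M\<^sub>1 = "lay 0 1 \<alpha> \<union> lay 2 3 \<gamma>" and ?M\<^sub>2 = "lay 1 2 \<beta>"
  let ?A = "({0} \<times> X \<union> {1} \<times> Y) \<union> ({2} \<times> Z \<union> {3} \<times> W)" and ?B = "{1} \<times> Y \<union> {2} \<times> Z"
  let ?T = "adj ?M\<^sub>1 \<union> adj ?M\<^sub>2"
  let ?e = "emb 0 0 3"
  have fin: "finite X" "finite Y" "finite Z" "finite W" using diag_finite \<alpha> \<beta> \<gamma> by auto
  have m1: "matching ?A ?M\<^sub>1"
    by (intro matching_Un matching_lay[OF \<alpha>] matching_lay[OF \<gamma>]) auto
  have m2: "matching ?B ?M\<^sub>2" by (rule matching_lay[OF \<beta>]) simp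
  have f1: "finite ?M\<^sub>1" using finite_matching[OF _ m1] fin by simp
  have "?e ` pts X W = {0} \<times> X \<union> {3} \<times> W" by (force simp: pts_def)
  then have AB: "symd ?A ?B = ?e ` pts X W" by (auto simp: symd_def)
  obtain M where M: "matching (?e ` pts X W) M" 
    "\<And>u v. u \<in> ?e ` pts X W \<Longrightarrow> v \<in> ?e ` pts X W \<Longrightarrow> (u, v) \<in> ?T\<^sup>* \<Longrightarrow> u = v \<or> {u, v} \<in> M"
    by (rule matching_superpose[OF f1 m1 m2, unfolded AB]) (blast intro: that)
  have T: "adj (lay 0 1 \<alpha>) \<subseteq> ?T" "adj (lay 1 2 \<beta>) \<subseteq> ?T" "adj (lay 2 3 \<gamma>) \<subseteq> ?T" by auto
  have l: "\<alpha> \<bullet> \<beta> \<bullet> \<gamma> \<in> diag X W" and r: "\<alpha> \<bullet> (\<beta> \<bullet> \<gamma>) \<in> diag X W"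
    by (blast intro: comp_diag \<alpha> \<beta> \<gamma>)+
  have inj: "inj_on ?e (pts X W)" by (auto simp: inj_on_def pts_def)
  have "adj (lay 0 2 (\<alpha> \<bullet> \<beta>)) \<subseteq> ?T\<^sup>*"
    using adj_lay_comp[OF \<alpha> \<beta>, of 0 2 1] rtrancl_mono[of "adj (lay 0 1 \<alpha>) \<union> adj (lay 1 2 \<beta>)" ?T] T by blast
  then have S1: "(adj (lay 0 2 (\<alpha> \<bullet> \<beta>)) \<union> adj (lay 2 3 \<gamma>))\<^sup>* \<subseteq> ?T\<^sup>*"
    using T by (intro rtrancl_subset_rtrancl) auto
  have "adj (lay 1 3 (\<beta> \<bullet> \<gamma>)) \<subseteq> ?T\<^sup>*"
    using adj_lay_comp[OF \<beta> \<gamma>, of 1 3 2] rtrancl_mono[of "adj (lay 1 2 \<beta>) \<union> adj (lay 2 3 \<gamma>)" ?T] T by blast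
  then have S2: "(adj (lay 0 1 \<alpha>) \<union> adj (lay 1 3 (\<beta> \<bullet> \<gamma>)))\<^sup>* \<subseteq> ?T\<^sup>*"
    using T by (intro rtrancl_subset_rtrancl) auto
  \<comment> \<open>Both bracketings are compared with the common matching \<open>M\<close> through
    this fact; uniqueness of partners in \<open>M\<close> then identifies them.\<close>
  have main: "{?e u, ?e v} \<in> M"
    if "matching (pts X W) N" "{u, v} \<in> N" "(emb 0 j 3 u, emb 0 j 3 v) \<in> ?T\<^sup>*" for N u v j
  proof -
    have "w \<in> pts X W \<Longrightarrow> ?e w = emb 0 j 3 w" for w by (erule ptsE) auto
    moreover have "u \<in> pts X W" "v \<in> pts X W" "u \<noteq> v"
      using matching_mem[OF that(1,2)] matching_neq[OF that(1,2)] by auto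
    ultimately have *: "u \<in> pts X W" "v \<in> pts X W" "u \<noteq> v" "?e u = emb 0 j 3 u" "?e v = emb 0 j 3 v"
      by auto
    then have "?e u \<noteq> ?e v" using inj by (meson inj_onD)
    then show ?thesis using M(2)[OF imageI[OF *(1)] imageI[OF *(2)]] that(3) *(4,5) by simp
  qed
  have L: "{?e u, ?e v} \<in> M" if "{u, v} \<in> \<alpha> \<bullet> \<beta> \<bullet> \<gamma>" for u v
    using con_lay[OF comp_diag[OF \<alpha> \<beta>] \<gamma> comp_con[OF comp_diag[OF \<alpha> \<beta>] \<gamma> that], of 0 2 3] S1
    by (intro main[OF diag_matching[OF l] that, of 2]) auto
  have R: "{?e u, ?e v} \<in> M" if "{u, v} \<in> \<alpha> \<bullet> (\<beta> \<bullet> \<gamma>)" for u v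
    using con_lay[OF \<alpha> comp_diag[OF \<beta> \<gamma>] comp_con[OF \<alpha> comp_diag[OF \<beta> \<gamma>] that], of 0 1 3] S2
    by (intro main[OF diag_matching[OF r] that, of 1]) auto
  show ?thesis
  proof (rule matching_eqI[OF diag_matching[OF l] diag_matching[OF r]])
    fix u v assume uv: "{u, v} \<in> \<alpha> \<bullet> \<beta> \<bullet> \<gamma>"
    then have "u \<in> pts X W" "v \<in> pts X W" using matching_mem[OF diag_matching[OF l]] by blast+
    moreover obtain w where w: "{u, w} \<in> \<alpha> \<bullet> (\<beta> \<bullet> \<gamma>)"
      using matching_partner[OF diag_matching[OF r] \<open>u \<in> pts X W\<close>] .
    moreover have "w \<in> pts X W" using w matching_mem[OF diag_matching[OF r]] by blast
    moreover have "?e v = ?e w" using matching_unique[OF M(1) L[OF uv] R[OF w]] .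
    ultimately show "{u, v} \<in> \<alpha> \<bullet> (\<beta> \<bullet> \<gamma>)" using inj by (metis inj_onD)
  qed
qed

section \<open>Turning diagrams upside down\<close>

fun flip :: "vertex \<Rightarrow> vertex" where
  "flip (Plain x) = Prime x"
| "flip (Prime x) = Plain x"
| "flip (DPrime x) = DPrime x"

definition star :: "partition \<Rightarrow> partition" where
  "star \<alpha> = (`) flip ` \<alpha>"

lemma flip_flip [simp]: "flip (flip v) = v"
  by (cases v) auto

lemma star_star [simp]: "star (star \<alpha>) = \<alpha>"
  by (simp add: star_def image_image)

lemma star_iff: "{u, v} \<in> star \<alpha> \<longleftrightarrow> {flip u, flip v} \<in> \<alpha>"
proof -
  have "{u, v} \<in> star \<alpha>" if "{flip u, flip v} \<in> \<alpha>" for u v \<alpha>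
    unfolding star_def by (rule image_eqI[OF _ that]) simp
  from this[of u v \<alpha>] this[of "flip u" "flip v" "star \<alpha>"] show ?thesis by auto
qed

lemma star_diag:
  assumes "\<alpha> \<in> diag X Y"
  shows "star \<alpha> \<in> diag Y X"
proof -
  have "inj_on flip (pts X Y)" by (metis flip_flip inj_onI)
  moreover have "flip ` pts X Y = pts Y X" by (force simp: pts_def)
  ultimately show ?thesis
    using assms matching_image[of "pts X Y" \<alpha> flip] by (auto simp: diag_def star_def)
qed

text \<open>The reflection swaps lowering with raising, so it maps the product graph of \<alpha>,
  \<beta> into that of \<open>star \<beta>\<close>, \<open>star \<alpha>\<close>.\<close>

lemma star_comp:
  assumes \<alpha>: "\<alpha> \<in> diag X Y" and \<beta>: "\<beta> \<in> diag Y Z"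
  shows "star (\<alpha> \<bullet> \<beta>) = star \<beta> \<bullet> star \<alpha>"
proof (rule sym, rule comp_eqI[OF star_diag[OF \<beta>] star_diag[OF \<alpha>] star_diag[OF comp_diag[OF \<alpha> \<beta>]]])
  fix u v assume "{u, v} \<in> star (\<alpha> \<bullet> \<beta>)"
  then have "con \<alpha> \<beta> (flip u) (flip v)" using comp_con[OF \<alpha> \<beta>] by (simp add: star_iff)
  then have "(flip (flip u), flip (flip v)) \<in> (product_graph (star \<beta>) (star \<alpha>))\<^sup>*"
    unfolding con_def
  proof (rule rtrancl_collapse)
    fix a b assume "(a, b) \<in> product_graph \<alpha> \<beta>"
    moreover have "flip (lower_vertex x) = raise_vertex (flip x)"
      "flip (raise_vertex x) = lower_vertex (flip x)" for x by (cases x; simp)+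
    ultimately show "(flip a, flip b) \<in> (product_graph (star \<beta>) (star \<alpha>))\<^sup>*"
      by (intro r_into_rtrancl) (fastforce simp: product_graph_def star_def)
  qed
  then show "con (star \<beta>) (star \<alpha>) u v" by (simp add: con_def)
qed

lemma comp_upper_hook:
  assumes "\<alpha> \<in> diag X Y" "\<beta> \<in> diag Y Z" "{Plain i, Plain j} \<in> \<alpha>"
  shows "{Plain i, Plain j} \<in> \<alpha> \<bullet> \<beta>"
proof -
  note m = diag_matching[OF assms(1)]
  have "i \<in> X" "j \<in> X" "i \<noteq> j" using matching_mem[OF m assms(3)] matching_neq[OF m assms(3)] by auto
  then show ?thesis
    using comp_iff[OF assms(1,2), of "Plain i" "Plain j"] con_lower[OF assms(3), of \<beta>] by simp
qed

lemma comp_lower_hook: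
  assumes "\<alpha> \<in> diag X Y" "\<beta> \<in> diag Y Z" "{Prime i, Prime j} \<in> \<beta>"
  shows "{Prime i, Prime j} \<in> \<alpha> \<bullet> \<beta>"
proof -
  note m = diag_matching[OF assms(2)]
  have "i \<in> Z" "j \<in> Z" "i \<noteq> j" using matching_mem[OF m assms(3)] matching_neq[OF m assms(3)] by auto
  then show ?thesis
    using comp_iff[OF assms(1,2), of "Prime i" "Prime j"] con_raise[OF assms(3), of \<alpha>] by simp
qed

section \<open>Diagrams of injections and identities\<close>

definition pdiag :: "nat set \<Rightarrow> (nat \<Rightarrow> nat) \<Rightarrow> partition" where
  "pdiag X f = (\<lambda>x. {Plain x, Prime (f x)}) ` X"

lemma pdiag_iff: "{u, v} \<in> pdiag X f \<longleftrightarrow>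
   (\<exists>x\<in>X. u = Plain x \<and> v = Prime (f x) \<or> v = Plain x \<and> u = Prime (f x))"
  by (auto simp: pdiag_def doubleton_eq_iff)

lemma pdiag_diag:
  assumes "finite X" "inj_on f X"
  shows "pdiag X f \<in> diag X (f ` X)"
proof -
  have "matching (pts X (f ` X)) (pdiag X f)"
  proof (rule matchingI)
    show "\<exists>u v. u \<noteq> v \<and> B = {u, v}" if "B \<in> pdiag X f" for B
      using that unfolding pdiag_def by blast
    show "\<Union>(pdiag X f) = pts X (f ` X)" by (auto simp: pdiag_def pts_def)
    show "v = w" if "{u, v} \<in> pdiag X f" "{u, w} \<in> pdiag X f" for u v w
      using that assms(2) by (auto simp: pdiag_iff dest: inj_onD)
  qed
  then show ?thesis using assms by (simp add: diag_def)
qed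

definition idd :: "nat set \<Rightarrow> partition" where
  "idd X = pdiag X id"

lemma idd_diag: "finite X \<Longrightarrow> idd X \<in> diag X X"
  using pdiag_diag[of X id] by (simp add: idd_def)

lemma idd_iff: "{u, v} \<in> idd X \<longleftrightarrow>
   (\<exists>x\<in>X. u = Plain x \<and> v = Prime x \<or> v = Plain x \<and> u = Prime x)"
  by (simp add: idd_def pdiag_iff)

lemma star_idd: "star (idd X) = idd X"
  by (auto simp: star_def idd_def pdiag_def image_image insert_commute)

text \<open>An identity strand links an upper vertex to its copy in the middle row, and
  \<open>raise_vertex\<close> fixes lower vertices, so both kinds of outer vertex are covered at
  once.\<close>

lemma con_idd_raise:
  assumes "idd X \<subseteq> \<alpha>" "u \<in> pts X Z"
  shows "con \<alpha> \<beta> u (raise_vertex u)"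
  using assms(2)
proof (rule ptsE)
  fix x assume "u = Plain x" "x \<in> X"
  moreover have "{Plain x, Prime x} \<in> idd X" using \<open>x \<in> X\<close> by (simp add: idd_iff)
  ultimately show ?thesis using con_lower[of "Plain x" "Prime x" \<alpha> \<beta>] assms(1) by auto
qed simp

lemma con_idd_lower:
  assumes "idd X \<subseteq> \<beta>" "u \<in> pts Z X"
  shows "con \<alpha> \<beta> u (lower_vertex u)"
  using assms(2)
proof (rule ptsE)
  fix x assume "u = Prime x" "x \<in> X"
  moreover have "{Prime x, Plain x} \<in> idd X" using \<open>x \<in> X\<close> by (simp add: idd_iff)
  ultimately show ?thesis using con_raise[of "Prime x" "Plain x" \<beta> \<alpha>] assms(1) by auto
qed simp

text \<open>The recurring pattern for outer vertices: carry both into the middle row and use one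
  block of a factor there.\<close>

lemma con_via: "con \<alpha> \<beta> u u' \<Longrightarrow> con \<alpha> \<beta> u' v' \<Longrightarrow> con \<alpha> \<beta> v v' \<Longrightarrow> con \<alpha> \<beta> u v"
  by (rule con_trans[OF _ con_trans[OF _ con_sym]])

lemma comp_idd_left:
  assumes "\<alpha> \<in> diag X Y"
  shows "idd X \<bullet> \<alpha> = \<alpha>"
proof (rule comp_eqI[OF idd_diag[OF diag_finite(1)[OF assms]] assms assms])
  fix u v assume uv: "{u, v} \<in> \<alpha>"
  have "u \<in> pts X Y" "v \<in> pts X Y" using matching_mem[OF diag_matching[OF assms] uv] by auto
  then show "con (idd X) \<alpha> u v"
    by (intro con_via[OF con_idd_raise con_raise[OF uv] con_idd_raise]) auto
qed

lemma comp_idd_right: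
  assumes "\<alpha> \<in> diag X Y"
  shows "\<alpha> \<bullet> idd Y = \<alpha>"
proof -
  have "star (\<alpha> \<bullet> idd Y) = star \<alpha>"
    using star_comp[OF assms idd_diag[OF diag_finite(2)[OF assms]]] comp_idd_left[OF star_diag[OF assms]]
    by (simp add: star_idd)
  then show ?thesis by (metis star_star)
qed

section \<open>Inserting a pair of points\<close>

definition partner :: "'a set set \<Rightarrow> 'a \<Rightarrow> 'a" where
  "partner M v = (THE w. {v, w} \<in> M)"

text \<open>Every matching of \<open>V \<union> {p, q}\<close> arises from a matching of \<open>V\<close> by inserting \<open>p\<close> and \<open>q\<close> into the
  edge at \<open>v\<close>, with \<open>p\<close> next to \<open>v\<close>, or by adding the edge \<open>{p, q}\<close>; the latter case is coded by
  \<open>v = q\<close>.\<close>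

definition ins :: "'a set set \<Rightarrow> 'a \<Rightarrow> 'a \<Rightarrow> 'a \<Rightarrow> 'a set set" where
  "ins a p q v = (if v = q then insert {p, q} a
     else insert {p, v} (insert {q, partner a v} (a - {{v, partner a v}})))"

lemma partner_eq:
  assumes "matching V M" "{v, w} \<in> M"
  shows "partner M v = w"
  unfolding partner_def using assms(2) matching_unique[OF assms(1) _ assms(2)] by (rule the_equality)

lemma ins_self [simp]: "ins a p q q = insert {p, q} a"
  by (simp add: ins_def)

lemma ins_other:
  assumes "matching V a" "{v, w} \<in> a" "q \<notin> V"
  shows "ins a p q v = insert {p, v} (insert {q, w} (a - {{v, w}}))"
  using partner_eq[OF assms(1,2)] matching_mem[OF assms(1,2)] assms(3) by (auto simp: ins_def)

text \<open>The same picture read from the other end of the cut edge; it serves the case where only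
  \<open>w\<close> is an upper vertex.\<close>

lemma ins_swap:
  assumes "matching V a" "{v, w} \<in> a" "p \<notin> V" "q \<notin> V"
  shows "ins a p q v = ins a q p w"
proof -
  have "{w, v} \<in> a" using assms(2) by (simp add: insert_commute)
  then show ?thesis
    using ins_other[OF assms(1,2,4), of p] ins_other[OF assms(1) _ assms(3), of w v q]
    by (simp add: insert_commute)
qed

lemma matching_ins:
  assumes "matching V a" "p \<noteq> q" "p \<notin> V" "q \<notin> V" "v \<in> insert q V"
  shows "matching (insert p (insert q V)) (ins a p q v)"
proof (cases "v = q")
  case True
  then show ?thesis using matching_insert[OF assms(1-4)] by simp
next
  case False
  then have "v \<in> V" using assms(5) by simp
  obtain w where w: "{v, w} \<in> a" "v \<noteq> w" using matching_partner[OF assms(1) \<open>v \<in> V\<close>] .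
  then have "w \<in> V" using matching_mem[OF assms(1)] by blast
  have "matching (insert p (insert v (insert q (insert w (V - {v, w})))))
      (insert {p, v} (insert {q, w} (a - {{v, w}})))"
    using assms(2-4) w(2) \<open>v \<in> V\<close> \<open>w \<in> V\<close>
    by (intro matching_insert matching_remove[OF assms(1) w(1)]) auto
  moreover have "insert p (insert v (insert q (insert w (V - {v, w})))) = insert p (insert q V)"
    using \<open>v \<in> V\<close> \<open>w \<in> V\<close> by blast
  ultimately show ?thesis using ins_other[OF assms(1) w(1) assms(4)] by simp
qed

lemma ins_mem: "{p, v} \<in> ins a p q v"
  by (simp add: ins_def)

text \<open>The position is recovered as the partner of \<open>p\<close>.\<close>

lemma inj_on_ins:
  assumes "matching V a" "p \<noteq> q" "p \<notin> V" "q \<notin> V"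
  shows "inj_on (ins a p q) (insert q V)"
proof (rule inj_onI)
  fix v w assume vw: "v \<in> insert q V" "w \<in> insert q V" "ins a p q v = ins a p q w"
  show "v = w"
    using matching_unique[OF matching_ins[OF assms vw(1)] ins_mem, of w] ins_mem[of p w a q] vw(3)
    by simp
qed

lemma ins_exhaust:
  assumes M: "matching (insert p (insert q V)) M" and "p \<noteq> q" "p \<notin> V" "q \<notin> V"
  obtains a v where "matching V a" "v \<in> insert q V" "M = ins a p q v"
proof -
  \<comment> \<open>The position has to be the partner of \<open>p\<close>; deleting the blocks at
    \<open>p\<close> and \<open>q\<close> and joining their other ends undoes the insertion.\<close>
  obtain v where v: "{p, v} \<in> M" "p \<noteq> v" using matching_partner[OF M, of p] by auto
  have "v \<in> insert q V" using matching_mem[OF M v(1)] v(2) by blast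
  show thesis
  proof (cases "v = q")
    case True
    have "matching V (M - {{p, q}})"
      using matching_remove[OF M, of p q] v assms True by (simp add: insert_Diff_if Diff_insert0)
    moreover have "M = ins (M - {{p, q}}) p q q" using v True by auto
    ultimately show thesis using that by blast
  next
    case False
    obtain w where w: "{q, w} \<in> M" "q \<noteq> w" using matching_partner[OF M, of q] by auto
    have "w \<noteq> p" "w \<noteq> v"
      using matching_unique[OF M, of p v q] matching_unique[OF M, of v p q] v w False assms(2)
      by (auto simp: insert_commute)
    have wV: "w \<in> V" "v \<in> V" using matching_mem[OF M w(1)] w(2) \<open>w \<noteq> p\<close> \<open>v \<in> insert q V\<close> False by auto
    have vw: "{v, w} \<notin> M"
      using matching_unique[OF M, of v p w] v \<open>w \<noteq> p\<close> by (auto simp: insert_commute)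
    let ?N = "M - {{p, v}} - {{q, w}}"
    have "{q, w} \<in> M - {{p, v}}" using w assms(2) False by (auto simp: doubleton_eq_iff)
    then have N: "matching (insert p (insert q V) - {p, v} - {q, w}) ?N"
      by (intro matching_remove M v(1))
    have "insert p (insert q V) - {p, v} - {q, w} = V - {v, w}"
      using assms by auto
    with N have "matching (insert v (insert w (V - {v, w}))) (insert {v, w} ?N)"
      using \<open>w \<noteq> v\<close> by (intro matching_insert) auto
    moreover have "insert v (insert w (V - {v, w})) = V" using wV by auto
    ultimately have a: "matching V (insert {v, w} ?N)" by simp
    have "ins (insert {v, w} ?N) p q v = insert {p, v} (insert {q, w} (insert {v, w} ?N - {{v, w}}))"
      by (rule ins_other[OF a _ assms(4)]) simp
    also have "\<dots> = M" using vw v w by auto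
    finally show thesis using that a \<open>v \<in> insert q V\<close> by blast
  qed
qed

section \<open>Caps and their fibres\<close>

definition cap :: "nat \<Rightarrow> nat \<Rightarrow> nat set \<Rightarrow> partition" where
  "cap p q X = insert {Prime p, Prime q} (idd X)"

lemma pts_insert2: "pts (insert p (insert q X)) Z = insert (Plain p) (insert (Plain q) (pts X Z))"
  "pts X (insert p (insert q Z)) = insert (Prime p) (insert (Prime q) (pts X Z))"
  by (auto simp: pts_def)

lemma cap_diag:
  assumes "finite X" "p \<noteq> q" "p \<notin> X" "q \<notin> X"
  shows "cap p q X \<in> diag X (insert p (insert q X))"
  using matching_insert[OF diag_matching[OF idd_diag[OF assms(1)]], of "Prime p" "Prime q"] assms
  by (simp add: cap_def diag_def pts_insert2)

lemma idd_subset_cap: "idd X \<subseteq> cap p q X"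
  by (auto simp: cap_def)

lemma cap_commute: "cap p q X = cap q p X"
  by (simp add: cap_def insert_commute)

lemma ins_diag:
  assumes "a \<in> diag X Z" "p \<noteq> q" "p \<notin> X" "q \<notin> X" "v \<in> insert (Plain q) (pts X Z)"
  shows "ins a (Plain p) (Plain q) v \<in> diag (insert p (insert q X)) Z"
proof -
  have "matching (pts (insert p (insert q X)) Z) (ins a (Plain p) (Plain q) v)"
    unfolding pts_insert2 using assms by (intro matching_ins diag_matching) auto
  then show ?thesis using diag_finite[OF assms(1)] by (simp add: diag_def)
qed

text \<open>The insertion may have cut an edge \<open>{v, z}\<close>. The detour from
  \<open>v\<close> to \<open>p\<close>, along the lower hook of the cap to \<open>q\<close> and on
  to \<open>z\<close> restores it.\<close>

lemma cap_ins:
  assumes a: "a \<in> diag X Z" and pq: "p \<noteq> q" "p \<notin> X" "q \<notin> X"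
    and v: "v \<in> insert (Plain q) (pts X Z)"
  shows "cap p q X \<bullet> ins a (Plain p) (Plain q) v = a"
proof (rule comp_eqI[OF cap_diag ins_diag[OF assms] a])
  show "finite X" using diag_finite a by blast
  let ?c = "cap p q X" and ?a = "ins a (Plain p) (Plain q) v"
  fix u w assume uw: "{u, w} \<in> a"
  note m = diag_matching[OF a]
  have "u \<in> pts X Z" "w \<in> pts X Z" using matching_mem[OF m uw] by auto
  then have r: "con ?c ?a u (raise_vertex u)" "con ?c ?a w (raise_vertex w)"
    using con_idd_raise[OF idd_subset_cap] by auto
  show "con ?c ?a u w"
  proof (cases "{u, w} \<in> ?a")
    case True
    show ?thesis by (rule con_via[OF r(1) con_raise[OF True] r(2)])
  next
    case False
    then have "v \<noteq> Plain q" using uw by auto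
    then have "v \<in> pts X Z" using v by simp
    obtain z where z: "{v, z} \<in> a" using matching_partner[OF m \<open>v \<in> pts X Z\<close>] .
    have a': "?a = insert {Plain p, v} (insert {Plain q, z} (a - {{v, z}}))"
      using ins_other[OF m z] pq by simp
    have "{u, w} = {v, z}" using False uw unfolding a' by auto
    have h: "con ?c ?a (DPrime p) (DPrime q)"
      using con_lower[of "Prime p" "Prime q" ?c ?a] by (simp add: cap_def)
    have pv: "con ?c ?a (raise_vertex v) (DPrime p)"
      using con_raise[of v "Plain p" ?a ?c] a' by (simp add: insert_commute)
    have qz: "con ?c ?a (DPrime q) (raise_vertex z)"
      using con_raise[of "Plain q" z ?a ?c] a' by (simp add: insert_commute)
    have "con ?c ?a (raise_vertex v) (raise_vertex z)"
      by (rule con_trans[OF con_trans[OF pv h] qz])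
    then have "con ?c ?a (raise_vertex u) (raise_vertex w)"
      using \<open>{u, w} = {v, z}\<close> con_sym by (auto simp: doubleton_eq_iff)
    then show ?thesis by (rule con_via[OF r(1) _ r(2)])
  qed
qed (use pq in auto)

lemma ins_exhaust_diag:
  assumes "x \<in> diag (insert p (insert q X)) Z" "p \<noteq> q" "p \<notin> X" "q \<notin> X"
  obtains v where "v \<in> insert (Plain q) (pts X Z)" "x = ins (cap p q X \<bullet> x) (Plain p) (Plain q) v"
proof -
  obtain a v where av: "matching (pts X Z) a" "v \<in> insert (Plain q) (pts X Z)" "x = ins a (Plain p) (Plain q) v"
    using ins_exhaust[of "Plain p" "Plain q" "pts X Z" x] diag_matching[OF assms(1)] assms(2-4)
    unfolding pts_insert2 by auto
  have "a \<in> diag X Z" using av(1) diag_finite[OF assms(1)] by (simp add: diag_def)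
  then have "cap p q X \<bullet> x = a" using cap_ins[OF _ assms(2-4) av(2)] av(3) by simp
  then show thesis using that av by simp
qed

lemma card_pts:
  assumes "finite X" "finite Y"
  shows "card (pts X Y) = card X + card Y"
  unfolding pts_def using assms by (subst card_Un_disjoint) (auto simp: card_image inj_on_def)

text \<open>The fibre consists of the insertions into \<open>a\<close>: one position for every
  vertex of \<open>a\<close>, and one more for the separate edge between the new points.\<close>

lemma card_cap_fibre:
  assumes a: "a \<in> diag X Z" and pq: "p \<noteq> q" "p \<notin> X" "q \<notin> X"
  shows "card {x \<in> diag (insert p (insert q X)) Z. cap p q X \<bullet> x = a} = card X + card Z + 1"
proof -
  have "{x \<in> diag (insert p (insert q X)) Z. cap p q X \<bullet> x = a} =
      ins a (Plain p) (Plain q) ` insert (Plain q) (pts X Z)"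
  proof (intro subset_antisym subsetI)
    fix x assume "x \<in> {x \<in> diag (insert p (insert q X)) Z. cap p q X \<bullet> x = a}"
    then have x: "x \<in> diag (insert p (insert q X)) Z" "cap p q X \<bullet> x = a" by auto
    obtain v where "v \<in> insert (Plain q) (pts X Z)" "x = ins (cap p q X \<bullet> x) (Plain p) (Plain q) v"
      using ins_exhaust_diag[OF x(1) pq] .
    then show "x \<in> ins a (Plain p) (Plain q) ` insert (Plain q) (pts X Z)" using x(2) by blast
  next
    fix x assume "x \<in> ins a (Plain p) (Plain q) ` insert (Plain q) (pts X Z)"
    then obtain v where "v \<in> insert (Plain q) (pts X Z)" "x = ins a (Plain p) (Plain q) v" by blast
    then show "x \<in> {x \<in> diag (insert p (insert q X)) Z. cap p q X \<bullet> x = a}"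
      using ins_diag[OF a pq] cap_ins[OF a pq] by simp
  qed
  moreover have "inj_on (ins a (Plain p) (Plain q)) (insert (Plain q) (pts X Z))"
    using pq by (intro inj_on_ins diag_matching[OF a]) auto
  moreover have "finite (pts X Z)" "Plain q \<notin> pts X Z"
    using diag_finite[OF a] pq by (auto simp: pts_def)
  ultimately show ?thesis using card_pts[OF diag_finite[OF a]] by (simp add: card_image)
qed

text \<open>As the insertion takes place at an upper vertex, it can be carried out on the identity;
  left multiplication by the resulting diagram then performs it on \<open>x\<close>.\<close>

lemma cap_section_aux:
  assumes x: "x \<in> diag X Z" and pq: "p \<noteq> q" "p \<notin> X" "q \<notin> X" and kw: "{Plain k, w} \<in> x"
  obtains a where "a \<in> diag (insert p (insert q X)) X" "cap p q X \<bullet> a = idd X"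
    "a \<bullet> x = ins x (Plain p) (Plain q) (Plain k)"
proof
  note m = diag_matching[OF x]
  have fin: "finite X" using diag_finite x by blast
  have k: "k \<in> X" and w: "w \<in> pts X Z" "w \<noteq> Plain k"
    using matching_mem[OF m kw] matching_neq[OF m kw] by auto
  let ?a = "ins (idd X) (Plain p) (Plain q) (Plain k)"
  show a: "?a \<in> diag (insert p (insert q X)) X" "cap p q X \<bullet> ?a = idd X"
    using k by (simp_all add: ins_diag[OF idd_diag[OF fin] pq] cap_ins[OF idd_diag[OF fin] pq])
  have a_eq: "?a = insert {Plain p, Plain k} (insert {Plain q, Prime k} (idd X - {{Plain k, Prime k}}))"
    using k pq by (intro ins_other[OF diag_matching[OF idd_diag[OF fin]]]) (auto simp: idd_iff)
  have x_eq: "ins x (Plain p) (Plain q) (Plain k) =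
      insert {Plain p, Plain k} (insert {Plain q, w} (x - {{Plain k, w}}))"
    using pq by (intro ins_other[OF m kw]) auto
  have r: "con ?a x u (raise_vertex u)" if "u \<in> pts X Z" "u \<noteq> Plain k" for u
    using that(1)
  proof (rule ptsE)
    fix y assume "u = Plain y" "y \<in> X"
    moreover have "{Plain y, Prime y} \<in> ?a"
      using \<open>u = Plain y\<close> \<open>y \<in> X\<close> that(2) unfolding a_eq by (auto simp: idd_iff doubleton_eq_iff)
    ultimately show ?thesis using con_lower[of "Plain y" "Prime y" ?a x] by simp
  qed simp
  show "?a \<bullet> x = ins x (Plain p) (Plain q) (Plain k)"
  proof (rule comp_eqI[OF a(1) x ins_diag[OF x pq]])
    show "Plain k \<in> insert (Plain q) (pts X Z)" using k by simp
    have h: "con ?a x (Plain p) (Plain k)"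
      using con_lower[of "Plain p" "Plain k" ?a x] unfolding a_eq by simp
    have qw: "con ?a x (Plain q) w"
    proof -
      have "con ?a x (Plain q) (DPrime k)"
        using con_lower[of "Plain q" "Prime k" ?a x] unfolding a_eq by simp
      also have "con ?a x (DPrime k) (raise_vertex w)" using con_raise[OF kw, of ?a] by simp
      also have "con ?a x (raise_vertex w) w" using con_sym[OF r[OF w]] .
      finally show ?thesis .
    qed
    fix u v assume "{u, v} \<in> ins x (Plain p) (Plain q) (Plain k)"
    then consider "{u, v} = {Plain p, Plain k}" | "{u, v} = {Plain q, w}"
      | "{u, v} \<in> x" "{u, v} \<noteq> {Plain k, w}" unfolding x_eq by auto
    then show "con ?a x u v"
    proof cases
      case 3
      have "u \<in> pts X Z" "v \<in> pts X Z" using matching_mem[OF m 3(1)] by auto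
      moreover have "u \<noteq> Plain k" using matching_unique[OF m kw, of v] 3 by auto
      moreover have "v \<noteq> Plain k"
        using matching_unique[OF m kw, of u] 3 by (auto simp: insert_commute)
      ultimately show ?thesis by (intro con_via[OF r con_raise[OF 3(1)] r])
    qed (use h qw con_sym in \<open>auto simp: doubleton_eq_iff\<close>)
  qed
qed

text \<open>In \<open>x\<close> the points \<open>p\<close> and \<open>q\<close> either form a block
  or sit on an edge of \<open>cap p q X \<bullet> x\<close>. If an end of that edge is an upper
  vertex, \<open>cap_section_aux\<close> applies; \<open>low\<close> excludes an edge between two
  lower vertices.\<close>

lemma cap_section:
  assumes x: "x \<in> diag (insert p (insert q X)) Z" and pq: "p \<noteq> q" "p \<notin> X" "q \<notin> X"
    and low: "\<And>i j. {Prime i, Prime j} \<in> cap p q X \<bullet> x \<Longrightarrow> {Prime i, Prime j} \<in> x"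
  obtains a where "a \<in> diag (insert p (insert q X)) X" "cap p q X \<bullet> a = idd X"
    "a \<bullet> (cap p q X \<bullet> x) = x"
proof -
  let ?y = "cap p q X \<bullet> x"
  have fin: "finite X" using diag_finite(1)[OF x] by simp
  have y: "?y \<in> diag X Z" by (rule comp_diag[OF cap_diag[OF fin pq] x])
  note m = diag_matching[OF y]
  obtain v where v: "v \<in> insert (Plain q) (pts X Z)" "x = ins ?y (Plain p) (Plain q) v"
    using ins_exhaust_diag[OF x pq] .
  show thesis
  proof (cases "v = Plain q")
    case True
    let ?a = "ins (idd X) (Plain p) (Plain q) (Plain q)"
    have a: "?a \<in> diag (insert p (insert q X)) X" "cap p q X \<bullet> ?a = idd X"
      by (simp_all only: ins_diag[OF idd_diag[OF fin] pq] cap_ins[OF idd_diag[OF fin] pq] insertI1)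
    have "?a \<bullet> ?y = x"
    proof (rule comp_eqI[OF a(1) y x])
      have r: "con ?a ?y u (raise_vertex u)" if "u \<in> pts X Z" for u
        by (rule con_idd_raise[OF _ that]) auto
      have xe: "x = insert {Plain p, Plain q} ?y" using v(2) unfolding True ins_self .
      fix u w assume "{u, w} \<in> x"
      then have "{u, w} \<in> insert {Plain p, Plain q} ?y" by (subst xe[symmetric])
      then consider "{u, w} = {Plain p, Plain q}" | "{u, w} \<in> ?y" by blast
      then show "con ?a ?y u w"
      proof cases
        case 1
        have "con ?a ?y (Plain p) (Plain q)" using con_lower[of "Plain p" "Plain q" ?a ?y] by simp
        then show ?thesis using 1 con_sym by (auto simp: doubleton_eq_iff)
      next
        case 2
        have "u \<in> pts X Z" "w \<in> pts X Z" using matching_mem[OF m 2] by auto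
        then show ?thesis by (intro con_via[OF r con_raise[OF 2] r])
      qed
    qed
    then show thesis using that a by blast
  next
    case False
    then have vp: "v \<in> pts X Z" using v(1) by simp
    obtain w where vw: "{v, w} \<in> ?y" using matching_partner[OF m vp] .
    have wp: "w \<in> pts X Z" using matching_mem[OF m vw] by simp
    have sw: "x = ins ?y (Plain q) (Plain p) w"
      using ins_swap[OF m vw, of "Plain p" "Plain q"] v(2) pq by simp
    consider k where "v = Plain k" | k where "w = Plain k" | i j where "v = Prime i" "w = Prime j"
      using vp wp by (auto elim!: ptsE)
    then show thesis
    proof cases
      case 1
      then show thesis using cap_section_aux[OF y pq, of k w] vw v(2) that by metis
    next
      case 2
      then have "{Plain k, v} \<in> ?y" using vw by (simp add: insert_commute)
      from cap_section_aux[OF y pq(1)[symmetric] pq(3,2) this] show thesis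
        using that sw 2 cap_commute[of p q X] insert_commute[of p q X] by metis
    next
      \<comment> \<open>By \<open>low\<close> the lower hook would be a block of \<open>x\<close>,
        but there \<open>Prime i\<close> is matched with \<open>Plain p\<close>.\<close>
      case 3
      then have "{Prime i, Prime j} \<in> x" using low vw by simp
      moreover have "{Prime i, Plain p} \<in> x" using ins_mem[of "Plain p" v ?y "Plain q"] v(2) 3
        by (simp add: insert_commute)
      ultimately show thesis using matching_unique[OF diag_matching[OF x]] by blast
    qed
  qed
qed

section \<open>Diagrams without upper hooks\<close>

text \<open>Every upper vertex then lies on a transversal, so the diagram has a right inverse
  (\<open>full_comp_star\<close>). The dual condition is written
  \<open>full (star \<rho>)\<close>.\<close>

definition full :: "partition \<Rightarrow> bool" where
  "full \<rho> \<longleftrightarrow> (\<forall>i j. {Plain i, Plain j} \<notin> \<rho>)"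

lemma full_star: "full (star \<rho>) \<longleftrightarrow> (\<forall>i j. {Prime i, Prime j} \<notin> \<rho>)"
  by (simp add: full_def star_iff)

lemma full_partner:
  assumes "\<rho> \<in> diag X Y" "full \<rho>" "x \<in> X"
  obtains y where "y \<in> Y" "{Plain x, Prime y} \<in> \<rho>"
proof -
  note m = diag_matching[OF assms(1)]
  have "Plain x \<in> pts X Y" using assms(3) by simp
  then obtain v where v: "{Plain x, v} \<in> \<rho>" using matching_partner[OF m] by blast
  then have "v \<in> pts X Y" using matching_mem[OF m] by blast
  then show thesis
    using that v assms(2) by (cases rule: ptsE) (auto simp: full_def)
qed

lemma full_function:
  assumes "\<rho> \<in> diag X Y" "full \<rho>"
  obtains f where "f ` X \<subseteq> Y" "inj_on f X" "\<And>x. x \<in> X \<Longrightarrow> {Plain x, Prime (f x)} \<in> \<rho>"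
proof -
  note m = diag_matching[OF assms(1)]
  have "\<forall>x\<in>X. \<exists>y. y \<in> Y \<and> {Plain x, Prime y} \<in> \<rho>" using full_partner[OF assms] by metis
  then obtain f where f: "\<forall>x\<in>X. f x \<in> Y \<and> {Plain x, Prime (f x)} \<in> \<rho>" by metis
  have "inj_on f X"
  proof (rule inj_onI)
    fix x y assume xy: "x \<in> X" "y \<in> X" "f x = f y"
    have "{Plain x, Prime (f x)} \<in> \<rho>" "{Plain y, Prime (f x)} \<in> \<rho>"
      using f xy by metis+
    then have "{Prime (f x), Plain x} \<in> \<rho>" "{Prime (f x), Plain y} \<in> \<rho>"
      by (simp_all add: insert_commute)
    then show "x = y" using matching_unique[OF m, of "Prime (f x)" "Plain x" "Plain y"] by simp
  qed
  then show thesis using that f by blast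
qed

lemma full_card_le:
  assumes "\<rho> \<in> diag X Y" "full \<rho>"
  shows "card X \<le> card Y"
  using full_function[OF assms] diag_finite[OF assms(1)] by (metis card_inj_on_le)

lemma full_comp_star:
  assumes "\<rho> \<in> diag X Y" "full \<rho>"
  shows "\<rho> \<bullet> star \<rho> = idd X"
proof (rule comp_eqI[OF assms(1) star_diag[OF assms(1)] idd_diag])
  show "finite X" using assms diag_finite by blast
  have *: "con \<rho> (star \<rho>) (Plain x) (Prime x)" if x: "x \<in> X" for x
  proof -
    obtain y where y: "{Plain x, Prime y} \<in> \<rho>" using full_partner[OF assms x] .
    then have "{Plain y, Prime x} \<in> star \<rho>" by (simp add: star_iff insert_commute)
    from con_raise[OF this, of \<rho>] have "con \<rho> (star \<rho>) (DPrime y) (Prime x)" by simp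
    with con_lower[OF y, of "star \<rho>"] show ?thesis by (auto intro: con_trans)
  qed
  show "con \<rho> (star \<rho>) u v" if "{u, v} \<in> idd X" for u v
    using that * con_sym by (auto simp: idd_iff)
qed

text \<open>Deleting a lower hook keeps a diagram full and shortens its lower row by two; once no
  lower hook is left, the diagram is a bijection between its rows.\<close>

lemma full_induct [consumes 2, case_names bij cap]:
  assumes "\<rho> \<in> diag C Y" "full \<rho>"
    and bij: "\<And>Y \<rho>. \<rho> \<in> diag C Y \<Longrightarrow> full \<rho> \<Longrightarrow> full (star \<rho>) \<Longrightarrow> P Y \<rho>"
    and cap: "\<And>X \<rho> p q. \<rho> \<in> diag C X \<Longrightarrow> full \<rho> \<Longrightarrow> p \<noteq> q \<Longrightarrow> p \<notin> X \<Longrightarrow> q \<notin> X \<Longrightarrow>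
      P X \<rho> \<Longrightarrow> P (insert p (insert q X)) (\<rho> \<bullet> cap p q X)"
  shows "P Y \<rho>"
  using assms(1,2)
proof (induction "card Y" arbitrary: Y \<rho> rule: less_induct)
  case less
  note m = diag_matching[OF less.prems(1)]
  show ?case
  proof (cases "full (star \<rho>)")
    case True
    then show ?thesis using bij less.prems by blast
  next
    case False
    then obtain p q where h: "{Prime p, Prime q} \<in> \<rho>" by (auto simp: full_star)
    have pq: "p \<noteq> q" "p \<in> Y" "q \<in> Y" using matching_mem[OF m h] matching_neq[OF m h] by auto
    let ?X = "Y - {p, q}" and ?\<rho> = "\<rho> - {{Prime p, Prime q}}"
    have fin: "finite C" "finite Y" using diag_finite less.prems by auto
    have "pts C Y - {Prime p, Prime q} = pts C ?X" by (auto simp: pts_def)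
    then have \<rho>: "?\<rho> \<in> diag C ?X" using matching_remove[OF m h] fin by (simp add: diag_def)
    have Y: "insert p (insert q ?X) = Y" using pq by auto
    have f: "full ?\<rho>" using less.prems(2) by (auto simp: full_def)
    have "card ?X < card Y" using fin pq by (intro psubset_card_mono) auto
    then have IH: "P ?X ?\<rho>" using less.hyps \<rho> f by blast
    have c: "cap p q ?X \<in> diag ?X Y" using cap_diag[of ?X p q] fin pq Y by simp
    have "?\<rho> \<bullet> cap p q ?X = \<rho>"
    proof (rule comp_eqI[OF \<rho> c less.prems(1)])
      fix u v assume uv: "{u, v} \<in> \<rho>"
      show "con ?\<rho> (cap p q ?X) u v"
      proof (cases "{u, v} = {Prime p, Prime q}")
        case True
        have "con ?\<rho> (cap p q ?X) (Prime p) (Prime q)"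
          using con_raise[of "Prime p" "Prime q" "cap p q ?X" ?\<rho>] by (simp add: cap_def)
        then show ?thesis using True con_sym by (auto simp: doubleton_eq_iff)
      next
        case False
        then have uv': "{u, v} \<in> ?\<rho>" using uv by simp
        have "u \<in> pts C ?X" "v \<in> pts C ?X" using matching_mem[OF diag_matching[OF \<rho>] uv'] by auto
        then show ?thesis by (intro con_via[OF con_idd_lower[OF idd_subset_cap] con_lower[OF uv'] con_idd_lower[OF idd_subset_cap]])
      qed
    qed
    then show ?thesis using cap[OF \<rho> f pq(1) _ _ IH] Y by simp
  qed
qed

definition sections :: "nat set \<Rightarrow> nat set \<Rightarrow> partition \<Rightarrow> partition set" where
  "sections C Y \<rho> = {a \<in> diag Y C. \<rho> \<bullet> a = idd C}"

text \<open>For a bijection the right inverse is unique and the two double factorials coincide. Each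
  cap multiplies the count by its fibre size, which is the next factor of the double factorial. The
  product form avoids division of naturals.\<close>

lemma card_sections:
  assumes "\<rho> \<in> diag C Y" "full \<rho>"
  shows "card (sections C Y \<rho>) * dfact (2 * int (card C) - 1) = dfact (int (card Y) + int (card C) - 1)"
  using assms
proof (induction rule: full_induct)
  case (bij Y \<rho>)
  have s: "star \<rho> \<bullet> \<rho> = idd Y"
    using full_comp_star[OF star_diag[OF bij(1)] bij(3)] by simp
  have "card C = card Y"
    using full_card_le[OF bij(1,2)] full_card_le[OF star_diag[OF bij(1)] bij(3)] by simp
  moreover have "sections C Y \<rho> = {star \<rho>}"
  proof (intro subset_antisym subsetI)
    fix a assume "a \<in> sections C Y \<rho>"
    then have a: "a \<in> diag Y C" "\<rho> \<bullet> a = idd C" by (auto simp: sections_def)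
    have "a = star \<rho> \<bullet> \<rho> \<bullet> a" using comp_idd_left[OF a(1)] s by simp
    also have "\<dots> = star \<rho>"
      using comp_assoc[OF star_diag[OF bij(1)] bij(1) a(1)] a(2) comp_idd_right[OF star_diag[OF bij(1)]] by simp
    finally show "a \<in> {star \<rho>}" by simp
  qed (simp add: sections_def star_diag[OF bij(1)] full_comp_star[OF bij(1,2)])
  ultimately show ?case by simp
next
  case (cap X \<rho> p q)
  let ?Y = "insert p (insert q X)"
  have fin: "finite X" "finite C" using diag_finite cap(1) by auto
  have c: "cap p q X \<in> diag X ?Y" using cap_diag[OF fin(1) cap(3-5)] .
  let ?F = "\<lambda>a. {x \<in> diag ?Y C. cap p q X \<bullet> x = a}"
  \<comment> \<open>By associativity the right inverses of the longer diagram are the fibres of the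
    cap over the right inverses of \<rho>.\<close>
  have "sections C ?Y (\<rho> \<bullet> cap p q X) = (\<Union>a\<in>sections C X \<rho>. ?F a)"
    using comp_diag[OF c] comp_assoc[OF cap(1) c] by (auto simp: sections_def)
  also have "card \<dots> = (\<Sum>a\<in>sections C X \<rho>. card (?F a))"
    using finite_diag by (intro card_UN_disjoint) (auto simp: sections_def)
  also have "\<dots> = (\<Sum>a\<in>sections C X \<rho>. card X + card C + 1)"
    by (intro sum.cong refl card_cap_fibre cap(3-5)) (simp add: sections_def)
  finally have "card (sections C ?Y (\<rho> \<bullet> cap p q X)) = card (sections C X \<rho>) * (card X + card C + 1)"
    by simp
  \<comment> \<open>The lower row has grown by two, so the leading factor
    \<open>card ?Y + card C - 1\<close> is the fibre size
    \<open>card X + card C + 1\<close>.\<close>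
  moreover have "dfact (int (card ?Y) + int (card C) - 1) =
      (card X + card C + 1) * dfact (int (card X) + int (card C) - 1)"
    using cap(3-5) fin by (subst dfact.simps) (simp add: nat_add_distrib algebra_simps)
  ultimately show ?case using cap.IH by (simp add: algebra_simps)
qed

text \<open>The assumption says that \<rho> creates no lower hooks. Then \<open>cap_section\<close>
  puts back, one cap at a time, what the cap has contracted, and these pieces combine to a right
  inverse of \<rho>.\<close>

lemma absorb:
  assumes "\<rho> \<in> diag C Y" "full \<rho>" "x \<in> diag Y Z"
    and "\<And>i j. {Prime i, Prime j} \<in> \<rho> \<bullet> x \<Longrightarrow> {Prime i, Prime j} \<in> x"
  shows "\<exists>a\<in>sections C Y \<rho>. a \<bullet> (\<rho> \<bullet> x) = x"
  using assms
proof (induction arbitrary: x rule: full_induct)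
  case (bij Y \<rho>)
  have s: "star \<rho> \<bullet> \<rho> = idd Y"
    using full_comp_star[OF star_diag[OF bij(1)] bij(3)] by simp
  have "star \<rho> \<bullet> (\<rho> \<bullet> x) = x"
    using comp_assoc[OF star_diag[OF bij(1)] bij(1,4)] s comp_idd_left[OF bij(4)] by simp
  moreover have "star \<rho> \<in> sections C Y \<rho>"
    by (simp add: sections_def star_diag[OF bij(1)] full_comp_star[OF bij(1,2)])
  ultimately show ?case by blast
next
  case (cap X \<rho> p q)
  let ?Y = "insert p (insert q X)" and ?c = "cap p q X"
  have fin: "finite X" using diag_finite(2)[OF cap(1)] .
  have c: "?c \<in> diag X ?Y" using cap_diag[OF fin cap(3-5)] .
  have x: "x \<in> diag ?Y Z" by (rule cap.prems)
  have cx: "?c \<bullet> x \<in> diag X Z" by (rule comp_diag[OF c x])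
  have as: "\<rho> \<bullet> ?c \<bullet> x = \<rho> \<bullet> (?c \<bullet> x)" by (rule comp_assoc[OF cap(1) c x])
  \<comment> \<open>Lower hooks survive left multiplication, so the assumption on the whole product
    passes to both of its stages.\<close>
  have l1: "{Prime i, Prime j} \<in> x" if "{Prime i, Prime j} \<in> ?c \<bullet> x" for i j
    using cap.prems(2) comp_lower_hook[OF cap(1) cx that] as by simp
  have l2: "{Prime i, Prime j} \<in> ?c \<bullet> x" if "{Prime i, Prime j} \<in> \<rho> \<bullet> (?c \<bullet> x)" for i j
    using cap.prems(2) comp_lower_hook[OF c x] that as by simp
  obtain a where a: "a \<in> diag X C" "\<rho> \<bullet> a = idd C" "a \<bullet> (\<rho> \<bullet> (?c \<bullet> x)) = ?c \<bullet> x"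
    using cap.IH[OF cx l2] by (auto simp: sections_def)
  obtain b where b: "b \<in> diag ?Y X" "?c \<bullet> b = idd X" "b \<bullet> (?c \<bullet> x) = x"
    using cap_section[OF x cap(3-5) l1] .
  have ba: "b \<bullet> a \<in> diag ?Y C" by (rule comp_diag[OF b(1) a(1)])
  have "\<rho> \<bullet> ?c \<bullet> (b \<bullet> a) = \<rho> \<bullet> (?c \<bullet> (b \<bullet> a))" by (rule comp_assoc[OF cap(1) c ba])
  also have "?c \<bullet> (b \<bullet> a) = a"
    using comp_assoc[OF c b(1) a(1)] b(2) comp_idd_left[OF a(1)] by simp
  finally have 1: "\<rho> \<bullet> ?c \<bullet> (b \<bullet> a) = idd C" using a(2) by simp
  have "b \<bullet> a \<bullet> (\<rho> \<bullet> ?c \<bullet> x) = b \<bullet> (a \<bullet> (\<rho> \<bullet> (?c \<bullet> x)))"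
    unfolding as by (rule comp_assoc[OF b(1) a(1) comp_diag[OF cap(1) cx]])
  then have "b \<bullet> a \<bullet> (\<rho> \<bullet> ?c \<bullet> x) = x" using a(3) b(3) by simp
  then show ?case using ba 1 by (auto simp: sections_def)
qed

section \<open>Singular diagrams are generated by hooks\<close>

definition hook :: "nat set \<Rightarrow> nat \<Rightarrow> nat \<Rightarrow> partition" where
  "hook C i j = insert {Plain i, Plain j} (insert {Prime i, Prime j} (idd (C - {i, j})))"

definition hooks :: "nat set \<Rightarrow> partition set" where
  "hooks C = {hook C i j | i j. i \<in> C \<and> j \<in> C \<and> i \<noteq> j}"

text \<open>With equal rows these are all diagrams on \<open>C\<close> except the permutations,
  compare \<open>full_pdiag\<close>.\<close>

definition sing :: "nat set \<Rightarrow> partition set" where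
  "sing C = {\<alpha> \<in> diag C C. \<not> full \<alpha>}"

lemma hook_commute: "hook C i j = hook C j i"
  by (simp add: hook_def insert_commute)

lemma hook_diag:
  assumes "finite C" "i \<in> C" "j \<in> C" "i \<noteq> j"
  shows "hook C i j \<in> diag C C"
proof -
  have "matching (insert (Plain i) (insert (Plain j) (insert (Prime i) (insert (Prime j)
      (pts (C - {i, j}) (C - {i, j})))))) (hook C i j)"
    unfolding hook_def using assms(1,4)
    by (intro matching_insert diag_matching[OF idd_diag]) auto
  moreover have "insert (Plain i) (insert (Plain j) (insert (Prime i) (insert (Prime j)
      (pts (C - {i, j}) (C - {i, j}))))) = pts C C"
    using assms by (auto simp: pts_def)
  ultimately show ?thesis using assms(1) by (simp add: diag_def)
qed

lemma hook_sing: "finite C \<Longrightarrow> i \<in> C \<Longrightarrow> j \<in> C \<Longrightarrow> i \<noteq> j \<Longrightarrow> hook C i j \<in> sing C"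
  using hook_diag[of C i j] by (auto simp: sing_def full_def hook_def)

lemma hook_upper_iff: "{Plain x, Plain y} \<in> hook C i j \<longleftrightarrow> {x, y} = {i, j}"
  by (auto simp: hook_def idd_iff doubleton_eq_iff)

lemma con_doubleton: "con \<alpha> \<beta> x y \<Longrightarrow> {u, v} = {x, y} \<Longrightarrow> con \<alpha> \<beta> u v"
  using con_sym by (auto simp: doubleton_eq_iff)

lemma con_idd:
  assumes "{u, v} \<in> idd X" "\<And>x. x \<in> X \<Longrightarrow> con \<alpha> \<beta> (Plain x) (Prime x)"
  shows "con \<alpha> \<beta> u v"
  using assms(1) unfolding idd_iff
proof
  fix x assume x: "x \<in> X" "u = Plain x \<and> v = Prime x \<or> v = Plain x \<and> u = Prime x"
  then show ?thesis using assms(2)[OF x(1)] by (elim con_doubleton) auto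
qed

lemma con_hook:
  assumes "u \<in> pts C Z" "u \<noteq> Plain i" "u \<noteq> Plain j"
  shows "con (hook C i j) \<beta> u (raise_vertex u)"
  using assms(1)
proof (rule ptsE)
  fix x assume "u = Plain x" "x \<in> C"
  then show ?thesis
    using con_lower[of "Plain x" "Prime x" "hook C i j" \<beta>] assms(2,3) by (simp add: hook_def idd_iff)
qed simp

lemma con_hook_lower: "con (hook C i j) \<beta> (DPrime i) (DPrime j)"
  using con_lower[of "Prime i" "Prime j" "hook C i j" \<beta>] by (simp add: hook_def)

lemma con_hook_upper: "con (hook C i j) \<beta> (Plain i) (Plain j)"
  using con_lower[of "Plain i" "Plain j" "hook C i j" \<beta>] by (simp add: hook_def)

text \<open>Cutting an upper and a lower hook and joining their ends in pairs gives two
  transversals, which the hook on the left closes up again. This trades \<alpha> for a diagram with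
  one upper hook less.\<close>

lemma hook_factor:
  assumes \<alpha>: "\<alpha> \<in> diag C C" and up: "{Plain i, Plain j} \<in> \<alpha>" and lo: "{Prime p, Prime q} \<in> \<alpha>"
  defines "\<beta> \<equiv> insert {Plain i, Prime p} (insert {Plain j, Prime q} (\<alpha> - {{Plain i, Plain j}} - {{Prime p, Prime q}}))"
  shows "\<beta> \<in> diag C C" "hook C i j \<bullet> \<beta> = \<alpha>"
proof -
  note m = diag_matching[OF \<alpha>]
  have ij: "i \<in> C" "j \<in> C" "i \<noteq> j" using matching_mem[OF m up] matching_neq[OF m up] by auto
  have pq: "p \<in> C" "q \<in> C" "p \<noteq> q" using matching_mem[OF m lo] matching_neq[OF m lo] by auto
  have fin: "finite C" using diag_finite(1)[OF \<alpha>] .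
  have lo': "{Prime p, Prime q} \<in> \<alpha> - {{Plain i, Plain j}}" using lo by (auto simp: doubleton_eq_iff)
  have "matching (insert (Plain i) (insert (Prime p) (insert (Plain j) (insert (Prime q)
      (pts C C - {Plain i, Plain j} - {Prime p, Prime q}))))) \<beta>"
    unfolding \<beta>_def using ij pq
    by (intro matching_insert matching_remove[OF matching_remove[OF m up] lo']) auto
  moreover have "insert (Plain i) (insert (Prime p) (insert (Plain j) (insert (Prime q)
      (pts C C - {Plain i, Plain j} - {Prime p, Prime q})))) = pts C C"
    using ij pq by auto
  ultimately show \<beta>: "\<beta> \<in> diag C C" using fin by (simp add: diag_def)
  let ?h = "hook C i j"
  show "?h \<bullet> \<beta> = \<alpha>"
  proof (rule comp_eqI[OF hook_diag[OF fin ij] \<beta> \<alpha>])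
    fix u v assume uv: "{u, v} \<in> \<alpha>"
    consider "{u, v} = {Plain i, Plain j}" | "{u, v} = {Prime p, Prime q}"
      | "{u, v} \<noteq> {Plain i, Plain j}" "{u, v} \<in> \<beta>"
      using uv by (auto simp: \<beta>_def)
    then show "con ?h \<beta> u v"
    proof cases
      case 1
      then show ?thesis by (rule con_doubleton[OF con_hook_upper])
    next
      case 2
      have "{Prime p, Plain i} \<in> \<beta>" "{Plain j, Prime q} \<in> \<beta>"
        by (simp_all add: \<beta>_def insert_commute)
      then have "con ?h \<beta> (Prime p) (DPrime i)" "con ?h \<beta> (DPrime j) (Prime q)"
        using con_raise[of "Prime p" "Plain i" \<beta> ?h] con_raise[of "Plain j" "Prime q" \<beta> ?h] by simp_all
      then have "con ?h \<beta> (Prime p) (Prime q)"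
        by (rule con_trans[OF con_trans[OF _ con_hook_lower]])
      then show ?thesis using 2 by (rule con_doubleton)
    next
      case 3
      have "u \<in> pts C C" "v \<in> pts C C" using matching_mem[OF m uv] by auto
      moreover have "w \<noteq> Plain i \<and> w \<noteq> Plain j" if "w \<in> {u, v}" for w
        using matching_block_eq[OF m uv _ up] matching_block_eq[OF m uv, of "Plain j" "Plain i"] up 3(1) that
        by (auto simp: insert_commute)
      ultimately show ?thesis by (intro con_via[OF con_hook con_raise[OF 3(2)] con_hook]) auto
    qed
  qed
qed

text \<open>By counting: the transversals from the whole upper row already exhaust the lower
  row.\<close>

lemma full_star_diag:
  assumes "\<alpha> \<in> diag C C" "full \<alpha>"
  shows "full (star \<alpha>)"
  unfolding full_star
proof (intro allI notI)
  fix p q assume h: "{Prime p, Prime q} \<in> \<alpha>"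
  note m = diag_matching[OF assms(1)]
  obtain f where f: "f ` C \<subseteq> C" "inj_on f C" "\<And>x. x \<in> C \<Longrightarrow> {Plain x, Prime (f x)} \<in> \<alpha>"
    by (rule full_function[OF assms]) (blast intro: that)
  have "f ` C = C" using endo_inj_surj[OF diag_finite(1)[OF assms(1)] f(1,2)] .
  moreover have "p \<in> C" using matching_mem[OF m h] by simp
  ultimately obtain x where "x \<in> C" "p = f x" by blast
  then have "{Prime p, Plain x} \<in> \<alpha>" using f(3)[of x] by (simp add: insert_commute)
  then show False using matching_unique[OF m h, of "Plain x"] by simp
qed

lemma full_pdiag:
  assumes "\<alpha> \<in> diag C C" "full \<alpha>"
  obtains f where "f permutes C" "\<alpha> = pdiag C f"
proof -
  note m = diag_matching[OF assms(1)]
  have fin: "finite C" using diag_finite(1)[OF assms(1)] .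
  obtain f where f: "f ` C \<subseteq> C" "inj_on f C" "\<And>x. x \<in> C \<Longrightarrow> {Plain x, Prime (f x)} \<in> \<alpha>"
    by (rule full_function[OF assms]) (blast intro: that)
  have fC: "f ` C = C" using endo_inj_surj[OF fin f(1,2)] .
  \<comment> \<open>\<open>permutes\<close> demands the identity outside \<open>C\<close>, where the
    diagram has no vertices.\<close>
  let ?g = "\<lambda>x. if x \<in> C then f x else x"
  have "bij_betw ?g C C"
    using f(2) fC by (auto simp: bij_betw_def inj_on_def)
  then have g: "?g permutes C" by (rule bij_imp_permutes) simp
  have "pdiag C f = \<alpha>"
  proof (rule matching_eqI[OF diag_matching m])
    show "pdiag C f \<in> diag C C" using pdiag_diag[OF fin f(2)] fC by simp
    show "{u, v} \<in> \<alpha>" if "{u, v} \<in> pdiag C f" for u v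
      using that f(3) by (auto simp: pdiag_iff insert_commute)
  qed
  moreover have "pdiag C ?g = pdiag C f" by (auto simp: pdiag_def)
  ultimately show thesis using that g by simp
qed

section \<open>Permutations acting on hooks\<close>

lemma pdiag_permutes: "finite C \<Longrightarrow> f permutes C \<Longrightarrow> pdiag C f \<in> diag C C"
  using pdiag_diag[of C f] permutes_inj_on[of f C C] permutes_image[of f C] by simp

lemma con_pdiag_left: "x \<in> C \<Longrightarrow> con (pdiag C f) \<beta> (Plain x) (DPrime (f x))"
  using con_lower[of "Plain x" "Prime (f x)" "pdiag C f" \<beta>] by (auto simp: pdiag_iff)

lemma con_pdiag_right: "x \<in> C \<Longrightarrow> con \<alpha> (pdiag C f) (DPrime x) (Prime (f x))"
  using con_raise[of "Plain x" "Prime (f x)" "pdiag C f" \<alpha>] by (auto simp: pdiag_iff)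

text \<open>Diagrams compose from top to bottom, hence the reversed order of the functions.\<close>

lemma pdiag_comp:
  assumes "finite C" "f permutes C" "g permutes C"
  shows "pdiag C f \<bullet> pdiag C g = pdiag C (g \<circ> f)"
proof (rule comp_eqI[OF pdiag_permutes pdiag_permutes pdiag_permutes])
  show "g \<circ> f permutes C" using assms by (intro permutes_compose)
  fix u v assume "{u, v} \<in> pdiag C (g \<circ> f)"
  then obtain x where x: "x \<in> C" "(u = Plain x \<and> v = Prime (g (f x))) \<or> (v = Plain x \<and> u = Prime (g (f x)))"
    by (auto simp: pdiag_iff)
  have "f x \<in> C" using x(1) assms(2) by (simp add: permutes_in_image)
  then have "con (pdiag C f) (pdiag C g) (Plain x) (Prime (g (f x)))"
    by (rule con_trans[OF con_pdiag_left[OF x(1)] con_pdiag_right])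
  then show "con (pdiag C f) (pdiag C g) u v" using x(2) con_sym by auto
qed (use assms in auto)

abbreviation tr :: "nat set \<Rightarrow> nat \<Rightarrow> nat \<Rightarrow> partition" where
  "tr C a b \<equiv> pdiag C (transpose a b)"

lemma tr_diag: "finite C \<Longrightarrow> a \<in> C \<Longrightarrow> b \<in> C \<Longrightarrow> tr C a b \<in> diag C C"
  by (intro pdiag_permutes permutes_swap_id)

text \<open>The transposition merely exchanges the two ends of the lower hook.\<close>

lemma hook_tr_same:
  assumes "finite C" "i \<in> C" "j \<in> C" "i \<noteq> j"
  shows "hook C i j \<bullet> tr C i j = hook C i j"
proof (rule comp_eqI[OF hook_diag[OF assms] tr_diag hook_diag[OF assms]])
  let ?h = "hook C i j" and ?t = "tr C i j"
  have "con ?h ?t (Prime j) (DPrime i)" "con ?h ?t (Prime i) (DPrime j)"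
    using con_sym[OF con_pdiag_right[OF assms(2), of ?h "transpose i j"]]
      con_sym[OF con_pdiag_right[OF assms(3), of ?h "transpose i j"]] by simp_all
  then have 1: "con ?h ?t (Prime i) (Prime j)"
    using con_via[OF _ con_sym[OF con_hook_lower]] by blast
  have 2: "con ?h ?t (Plain x) (Prime x)" if "x \<in> C - {i, j}" for x
  proof -
    have "con ?h ?t (Plain x) (DPrime x)" using that con_hook[of "Plain x" C C i j ?t] by simp
    moreover have "con ?h ?t (DPrime x) (Prime x)"
      using that con_pdiag_right[of x C ?h "transpose i j"] by (simp add: transpose_def)
    ultimately show ?thesis by (rule con_trans)
  qed
  fix u v assume "{u, v} \<in> hook C i j"
  then consider "{u, v} = {Plain i, Plain j}" | "{u, v} = {Prime i, Prime j}" | "{u, v} \<in> idd (C - {i, j})"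
    by (auto simp: hook_def)
  then show "con ?h ?t u v"
    by cases (blast intro: con_doubleton[OF con_hook_upper] con_doubleton[OF 1] con_idd[OF _ 2])+
qed (use assms in auto)

text \<open>Behind \<open>hook C i j\<close>, moving the end \<open>j\<close> of the lower hook to
  \<open>k\<close> has the same effect as a hook at \<open>i\<close> and \<open>k\<close>: both
  products have upper hook \<open>{i, j}\<close>, lower hook \<open>{i, k}\<close> and a strand from
  \<open>k\<close> to \<open>j\<close>.\<close>

lemma hook_tr_adjacent:
  assumes fin: "finite C" and C: "i \<in> C" "j \<in> C" "k \<in> C" and ne: "i \<noteq> j" "j \<noteq> k" "i \<noteq> k"
  shows "hook C i j \<bullet> tr C j k = hook C i j \<bullet> hook C i k"
proof -
  let ?g = "insert {Plain i, Plain j} (insert {Prime i, Prime k} (insert {Plain k, Prime j} (idd (C - {i, j, k}))))"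
  have "matching (insert (Plain i) (insert (Plain j) (insert (Prime i) (insert (Prime k)
      (insert (Plain k) (insert (Prime j) (pts (C - {i, j, k}) (C - {i, j, k})))))))) ?g"
    using fin ne by (intro matching_insert diag_matching[OF idd_diag]) auto
  moreover have "insert (Plain i) (insert (Plain j) (insert (Prime i) (insert (Prime k)
      (insert (Plain k) (insert (Prime j) (pts (C - {i, j, k}) (C - {i, j, k}))))))) = pts C C"
    using C by (auto simp: pts_def)
  ultimately have g: "?g \<in> diag C C" using fin by (simp add: diag_def)
  \<comment> \<open>Both products share the left factor, so only the connections contributed by the
    right factor remain to be checked.\<close>
  have main: "hook C i j \<bullet> \<beta> = ?g" if \<beta>: "\<beta> \<in> diag C C"
    and 1: "con (hook C i j) \<beta> (Prime i) (Prime k)" and 2: "con (hook C i j) \<beta> (DPrime k) (Prime j)"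
    and 3: "\<And>x. x \<in> C - {i, j, k} \<Longrightarrow> con (hook C i j) \<beta> (DPrime x) (Prime x)" for \<beta>
  proof (rule comp_eqI[OF hook_diag[OF fin C(1,2) ne(1)] \<beta> g])
    let ?h = "hook C i j"
    have x: "con ?h \<beta> (Plain x) (DPrime x)" if "x \<in> C - {i, j}" for x
      using that con_hook[of "Plain x" C C i j \<beta>] by simp
    have k: "con ?h \<beta> (Plain k) (Prime j)" using con_trans[OF x[of k] 2] C ne by simp
    have 4: "con ?h \<beta> (Plain x) (Prime x)" if "x \<in> C - {i, j, k}" for x
      using con_trans[OF x[of x] 3[OF that]] that by simp
    fix u v assume "{u, v} \<in> ?g"
    then consider "{u, v} = {Plain i, Plain j}" | "{u, v} = {Prime i, Prime k}"
      | "{u, v} = {Plain k, Prime j}" | "{u, v} \<in> idd (C - {i, j, k})"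
      by auto
    then show "con ?h \<beta> u v"
      by cases (blast intro: con_doubleton[OF con_hook_upper] con_doubleton[OF 1] con_doubleton[OF k]
        con_idd[OF _ 4])+
  qed
  have "hook C i j \<bullet> tr C j k = ?g"
  proof (rule main[OF tr_diag[OF fin C(2,3)]])
    let ?h = "hook C i j" and ?t = "tr C j k"
    have r: "con ?h ?t (DPrime x) (Prime (transpose j k x))" if "x \<in> C" for x
      using con_pdiag_right[OF that] .
    have "con ?h ?t (Prime i) (DPrime i)" "con ?h ?t (Prime k) (DPrime j)"
      using con_sym[OF r[OF C(1)]] con_sym[OF r[OF C(2)]] ne by (simp_all add: transpose_def)
    then show "con ?h ?t (Prime i) (Prime k)" by (rule con_via[OF _ con_hook_lower])
    show "con ?h ?t (DPrime k) (Prime j)" using r[OF C(3)] by simp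
    show "con ?h ?t (DPrime x) (Prime x)" if "x \<in> C - {i, j, k}" for x
      using r[of x] that by (simp add: transpose_def)
  qed
  moreover have "hook C i j \<bullet> hook C i k = ?g"
  proof (rule main[OF hook_diag[OF fin C(1,3) ne(3)]])
    let ?h = "hook C i j" and ?t = "hook C i k"
    show "con ?h ?t (Prime i) (Prime k)"
      using con_raise[of "Prime i" "Prime k" ?t ?h] by (simp add: hook_def)
    have "con ?h ?t (DPrime i) (DPrime k)"
      using con_raise[of "Plain i" "Plain k" ?t ?h] by (simp add: hook_def)
    moreover have r: "con ?h ?t (DPrime x) (Prime x)" if "x \<in> C - {i, k}" for x
      using con_raise[of "Plain x" "Prime x" ?t ?h] that by (simp add: hook_def idd_iff)
    ultimately show "con ?h ?t (DPrime k) (Prime j)"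
      using con_trans[OF con_sym con_trans[OF con_hook_lower r[of j]]] C ne by simp
    show "con ?h ?t (DPrime x) (Prime x)" if "x \<in> C - {i, j, k}" for x using r that by simp
  qed
  ultimately show ?thesis by simp
qed

lemma gen_closed:
  assumes "x \<in> gen f A" "A \<subseteq> B" "\<And>a b. a \<in> B \<Longrightarrow> b \<in> B \<Longrightarrow> f a b \<in> B"
  shows "x \<in> B"
  using assms(1) by induction (use assms(2,3) in auto)

lemma gen_hooks_diag:
  assumes "finite C" "x \<in> gen (\<bullet>) (hooks C)"
  shows "x \<in> diag C C"
  using assms(2) by (rule gen_closed) (use hook_diag[OF assms(1)] in \<open>auto simp: hooks_def intro: comp_diag\<close>)

text \<open>Only the last factor of a product meets the transposition, which reduces the claim to a
  single hook. The transposition then moves both of its ends, one of them or neither.\<close>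

lemma gen_hooks_tr:
  assumes fin: "finite C" and x: "x \<in> gen (\<bullet>) (hooks C)" and ab: "a \<in> C" "b \<in> C" "a \<noteq> b"
  shows "x \<bullet> tr C a b \<in> gen (\<bullet>) (hooks C)"
  using x
proof induction
  case (base x)
  then obtain i j where ij: "i \<in> C" "j \<in> C" "i \<noteq> j" "x = hook C i j" by (auto simp: hooks_def)
  have H: "hook C i j \<in> gen (\<bullet>) (hooks C)" if "i \<in> C" "j \<in> C" "i \<noteq> j" for i j
    by (rule gen.base) (use that in \<open>auto simp: hooks_def\<close>)
  note d = hook_diag[OF fin] and t = tr_diag[OF fin]
  have adj: "hook C i j \<bullet> tr C j k \<in> gen (\<bullet>) (hooks C)"
    if "i \<in> C" "j \<in> C" "k \<in> C" "i \<noteq> j" "j \<noteq> k" "i \<noteq> k" for i j k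
    unfolding hook_tr_adjacent[OF fin that] using that by (intro gen.mult H)
  consider "{a, b} = {i, j}" | "a = j" "b \<notin> {i, j}" | "a = i" "b \<notin> {i, j}"
    | "b = j" "a \<notin> {i, j}" | "b = i" "a \<notin> {i, j}" | "a \<notin> {i, j}" "b \<notin> {i, j}"
    using ab by blast
  then show ?case
  proof cases
    case 1
    then have "tr C a b = tr C i j" by (auto simp: doubleton_eq_iff transpose_commute)
    then show ?thesis using hook_tr_same[OF fin ij(1-3)] H[OF ij(1-3)] ij(4) by simp
  next
    case 2
    then show ?thesis using adj[of i j b] ij ab by auto
  next
    case 3
    then show ?thesis using adj[of j i b] ij ab hook_commute[of C i j] by auto
  next
    case 4
    then show ?thesis using adj[of i j a] ij ab transpose_commute[of a b] by auto
  next
    case 5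
    then show ?thesis using adj[of j i a] ij ab hook_commute[of C i j] transpose_commute[of a b] by auto
  next
    case 6
    \<comment> \<open>Write \<open>(a b) = (i a)(a b)(i b)\<close> (left factor first): then each transposition meets the hook
      produced so far.\<close>
    have ne: "i \<noteq> a" "i \<noteq> b" "j \<noteq> a" "j \<noteq> b" using 6 by auto
    have p: "transpose i a permutes C" "transpose a b permutes C" "transpose i b permutes C"
      using ij ab by (auto intro: permutes_swap_id)
    have "transpose i b \<circ> (transpose a b \<circ> transpose i a) = transpose a b"
      using ne ab(3) by (auto simp: transpose_def fun_eq_iff)
    then have tt: "tr C a b = tr C i a \<bullet> tr C a b \<bullet> tr C i b"
      using pdiag_comp[OF fin p(1,2)] pdiag_comp[OF fin permutes_compose[OF p(1,2)] p(3)]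
      by (simp add: o_assoc)
    let ?h = "hook C i j"
    have "?h \<bullet> tr C a b = ?h \<bullet> (tr C i a \<bullet> tr C a b \<bullet> tr C i b)" by (subst tt) simp
    also have "\<dots> = ?h \<bullet> tr C i a \<bullet> tr C a b \<bullet> tr C i b"
      using comp_assoc[OF d t comp_diag[OF t t]] comp_assoc[OF t t t] comp_assoc[OF d t t]
        comp_assoc[OF comp_diag[OF d t] t t] ij ab by simp
    also have "?h \<bullet> tr C i a = ?h \<bullet> hook C j a"
      using hook_tr_adjacent[OF fin ij(2,1) ab(1)] ij ne by (simp add: hook_commute[of C i j])
    also have "?h \<bullet> hook C j a \<bullet> tr C a b = ?h \<bullet> (hook C j a \<bullet> tr C a b)"
      using ij ab ne by (intro comp_assoc[OF d d t]) auto
    also have "hook C j a \<bullet> tr C a b = hook C j a \<bullet> hook C j b"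
      using ij ab ne by (intro hook_tr_adjacent[OF fin]) auto
    also have "?h \<bullet> (hook C j a \<bullet> hook C j b) \<bullet> tr C i b = ?h \<bullet> hook C j a \<bullet> (hook C j b \<bullet> tr C i b)"
      using comp_assoc[OF d d d, of i j j a j b] comp_assoc[OF comp_diag[OF d d] d t, of i j j a j b i b]
        ij ab ne by simp
    also have "\<dots> \<in> gen (\<bullet>) (hooks C)"
    proof (intro gen.mult[OF gen.mult[OF H H]])
      show "hook C j b \<bullet> tr C i b \<in> gen (\<bullet>) (hooks C)"
        using adj[of j b i] ij ab ne by (simp add: transpose_commute[of i b])
    qed (use ij ab ne in auto)
    finally show ?thesis using ij(4) by simp
  qed
next
  case (mult x y)
  have "x \<bullet> y \<bullet> tr C a b = x \<bullet> (y \<bullet> tr C a b)"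
    using gen_hooks_diag[OF fin] mult.hyps tr_diag[OF fin ab(1,2)] by (intro comp_assoc) auto
  then show ?case using mult by (simp add: gen.mult)
qed

lemma gen_hooks_pdiag:
  assumes fin: "finite C" and x: "x \<in> gen (\<bullet>) (hooks C)" and f: "f permutes C"
  shows "x \<bullet> pdiag C f \<in> gen (\<bullet>) (hooks C)"
  using f fin
proof (induction rule: permutes_induct)
  case id
  have "pdiag C id = idd C" by (simp add: idd_def)
  then show ?case using comp_idd_right[OF gen_hooks_diag[OF fin x]] x by metis
next
  case (swap a b p)
  have "pdiag C (transpose a b \<circ> p) = pdiag C p \<bullet> tr C a b"
    using swap by (intro pdiag_comp[symmetric] fin permutes_swap_id)
  then have "x \<bullet> pdiag C (transpose a b \<circ> p) = x \<bullet> pdiag C p \<bullet> tr C a b"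
    using comp_assoc[OF gen_hooks_diag[OF fin x] pdiag_permutes[OF fin] tr_diag[OF fin]] swap by metis
  then show ?case using gen_hooks_tr[OF fin] swap by metis
qed

text \<open>Peel off hooks on the left by \<open>hook_factor\<close>. The number of upper hooks
  drops until a permutation is left, which is absorbed by the hook in front of it.\<close>

lemma sing_gen_hooks:
  assumes "\<alpha> \<in> sing C"
  shows "\<alpha> \<in> gen (\<bullet>) (hooks C)"
  using assms
proof (induction "card {B \<in> \<alpha>. B \<subseteq> range Plain}" arbitrary: \<alpha> rule: less_induct)
  case less
  then have \<alpha>: "\<alpha> \<in> diag C C" and "\<not> full \<alpha>" by (auto simp: sing_def)
  note m = diag_matching[OF \<alpha>]
  have fin: "finite C" using diag_finite(1)[OF \<alpha>] .
  obtain i j where ij: "{Plain i, Plain j} \<in> \<alpha>" using \<open>\<not> full \<alpha>\<close> by (auto simp: full_def)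
  \<comment> \<open>The rows have equal size, so an upper hook entails a lower one.\<close>
  have "\<not> full (star \<alpha>)" using full_star_diag[OF star_diag[OF \<alpha>]] \<open>\<not> full \<alpha>\<close> by auto
  then obtain p q where pq: "{Prime p, Prime q} \<in> \<alpha>" by (auto simp: full_star)
  let ?\<beta> = "insert {Plain i, Prime p} (insert {Plain j, Prime q} (\<alpha> - {{Plain i, Plain j}} - {{Prime p, Prime q}}))"
  have \<beta>: "?\<beta> \<in> diag C C" "hook C i j \<bullet> ?\<beta> = \<alpha>" using hook_factor[OF \<alpha> ij pq] by auto
  have h: "hook C i j \<in> gen (\<bullet>) (hooks C)"
    using matching_mem[OF m ij] matching_neq[OF m ij] by (intro gen.base) (auto simp: hooks_def)
  have "?\<beta> \<in> gen (\<bullet>) (hooks C) \<or> full ?\<beta>"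
  proof (rule disjCI)
    assume "\<not> full ?\<beta>"
    moreover have "card {B \<in> ?\<beta>. B \<subseteq> range Plain} < card {B \<in> \<alpha>. B \<subseteq> range Plain}"
    proof (rule psubset_card_mono)
      have "finite \<alpha>" using finite_matching[OF _ m] fin by (simp add: pts_def)
      then show "finite {B \<in> \<alpha>. B \<subseteq> range Plain}" by simp
      have "{B \<in> ?\<beta>. B \<subseteq> range Plain} \<subseteq> {B \<in> \<alpha>. B \<subseteq> range Plain} - {{Plain i, Plain j}}"
        by auto
      moreover have "{Plain i, Plain j} \<in> {B \<in> \<alpha>. B \<subseteq> range Plain}" using ij by auto
      ultimately show "{B \<in> ?\<beta>. B \<subseteq> range Plain} \<subset> {B \<in> \<alpha>. B \<subseteq> range Plain}" by blast
    qed
    ultimately show "?\<beta> \<in> gen (\<bullet>) (hooks C)" using less.hyps[of ?\<beta>] \<beta>(1) by (simp add: sing_def)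
  qed
  then show ?case
  proof
    assume "full ?\<beta>"
    then obtain f where "f permutes C" "?\<beta> = pdiag C f" using full_pdiag[OF \<beta>(1)] by metis
    then show ?thesis using gen_hooks_pdiag[OF fin h] \<beta>(2) by metis
  qed (use gen.mult[OF h] \<beta>(2) in metis)
qed

lemma sing_comp:
  assumes "s \<in> sing C" "t \<in> diag C C"
  shows "s \<bullet> t \<in> sing C"
  using assms comp_diag[of s C C t C] comp_upper_hook[of s C C t C] by (auto simp: sing_def full_def)

lemma idd_not_sing: "idd C \<notin> sing C"
  by (auto simp: sing_def full_def idd_iff)

text \<open>A full diagram has a right inverse, which cancels one factor in
  \<open>s \<bullet> s = s\<close>.\<close>

lemma idempotent_full:
  assumes "s \<in> diag C C" "full s" "s \<bullet> s = s"
  shows "s = idd C"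
proof -
  note st = full_comp_star[OF assms(1,2)]
  have "s = s \<bullet> (s \<bullet> star s)" using st comp_idd_right[OF assms(1)] by simp
  also have "\<dots> = s \<bullet> s \<bullet> star s" by (rule comp_assoc[OF assms(1,1) star_diag[OF assms(1)], symmetric])
  finally show ?thesis using assms(3) st by simp
qed

section \<open>The idempotent-generated subsemigroup\<close>

lemma hook_idem:
  assumes "finite C" "i \<in> C" "j \<in> C" "i \<noteq> j"
  shows "hook C i j \<bullet> hook C i j = hook C i j"
proof (rule comp_eqI)
  let ?h = "hook C i j"
  show "?h \<in> diag C C" "?h \<in> diag C C" "?h \<in> diag C C" using hook_diag[OF assms] by blast+
  have lo: "con ?h ?h (Prime i) (Prime j)"
    using con_raise[of "Prime i" "Prime j" ?h ?h] by (simp add: hook_def)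
  have tv: "con ?h ?h (Plain x) (Prime x)" if "x \<in> C - {i, j}" for x
  proof -
    have b: "{Plain x, Prime x} \<in> ?h" using that by (simp add: hook_def idd_iff)
    show ?thesis
      using con_trans[of ?h ?h "Plain x" "DPrime x"] con_lower[OF b, of ?h] con_raise[OF b, of ?h] by simp
  qed
  fix u v assume "{u, v} \<in> ?h"
  then consider "{u, v} = {Plain i, Plain j}" | "{u, v} = {Prime i, Prime j}" | "{u, v} \<in> idd (C - {i, j})"
    by (auto simp: hook_def)
  then show "con ?h ?h u v"
    by cases (blast intro: con_doubleton[OF con_hook_upper] con_doubleton[OF lo] con_idd[OF _ tv])+
qed

text \<open>The invariant behind the lower bound: it can only grow under multiplication on the
  right, and it separates the hooks.\<close>

definition upper :: "partition \<Rightarrow> nat set set" where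
  "upper \<alpha> = {{i, j} | i j. {Plain i, Plain j} \<in> \<alpha>}"

lemma upper_hook: "upper (hook C i j) = {{i, j}}"
  by (auto simp: upper_def hook_upper_iff)

lemma inj_on_upper_hooks: "inj_on upper (hooks C)"
proof (rule inj_onI)
  fix x y assume "x \<in> hooks C" "y \<in> hooks C" "upper x = upper y"
  then obtain i j k l where "x = hook C i j" "y = hook C k l" "{i, j} = {k, l}"
    by (auto simp: hooks_def upper_hook)
  then show "x = y" using hook_commute by (auto simp: doubleton_eq_iff)
qed

lemma card_hooks:
  assumes "finite C"
  shows "card (hooks C) = card C choose 2"
proof -
  have "upper ` hooks C = (\<lambda>K. {K}) ` {K. K \<subseteq> C \<and> card K = 2}"
  proof (intro subset_antisym subsetI)
    fix U assume "U \<in> upper ` hooks C"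
    then obtain i j where "i \<in> C" "j \<in> C" "i \<noteq> j" "U = {{i, j}}" by (auto simp: hooks_def upper_hook)
    then show "U \<in> (\<lambda>K. {K}) ` {K. K \<subseteq> C \<and> card K = 2}" by auto
  next
    fix U assume "U \<in> (\<lambda>K. {K}) ` {K. K \<subseteq> C \<and> card K = 2}"
    then obtain i j where ij: "i \<in> C" "j \<in> C" "i \<noteq> j" "U = {{i, j}}" by (auto simp: card_2_iff)
    then have "hook C i j \<in> hooks C" by (auto simp: hooks_def)
    moreover have "U = upper (hook C i j)" using ij by (simp add: upper_hook)
    ultimately show "U \<in> upper ` hooks C" by blast
  qed
  then have "card (upper ` hooks C) = card {K. K \<subseteq> C \<and> card K = 2}"
    by (simp add: card_image)
  then show ?thesis using card_image[OF inj_on_upper_hooks] n_subsets[OF assms] by simp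
qed

lemma gen_mono: "A \<subseteq> B \<Longrightarrow> gen f A \<subseteq> gen f B"
  using gen_closed[of _ f A "gen f B"] by (auto intro: gen.intros)

lemma ex_surj_on:
  assumes "finite A" "finite B" "card B \<le> card A" "B \<noteq> {}"
  obtains g where "g ` A = B"
proof -
  obtain h where h: "h ` B \<subseteq> A" "inj_on h B" using card_le_inj[OF assms(2,1,3)] by blast
  obtain b where "b \<in> B" using assms(4) by blast
  \<comment> \<open>A left inverse of the injection \<open>h\<close>, with \<open>b\<close> as
    default value outside its image.\<close>
  have "(\<lambda>a. if a \<in> h ` B then inv_into B h a else b) ` A = B"
  proof (intro subset_antisym subsetI)
    fix y assume "y \<in> B"
    then have "y = inv_into B h (h y)" "h y \<in> A" "h y \<in> h ` B" using h by auto
    then show "y \<in> (\<lambda>a. if a \<in> h ` B then inv_into B h a else b) ` A"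
      by (intro image_eqI[of _ _ "h y"]) auto
  qed (use \<open>b \<in> B\<close> in \<open>auto simp: inv_into_into\<close>)
  then show thesis using that by blast
qed

section \<open>The sandwich semigroup in triple coordinates\<close>

locale factored_sandwich =
  fixes X Y C :: "nat set" and \<kappa> \<rho> :: partition and f :: "partition \<Rightarrow> partition \<Rightarrow> partition"
  assumes lam: "\<kappa> \<in> diag Y C" and rho: "\<rho> \<in> diag C X"
    and full_rho: "full \<rho>" and full_lam: "full (star \<kappa>)"
    and f_eq: "\<And>\<alpha> \<beta>. \<alpha> \<in> diag X Y \<Longrightarrow> \<beta> \<in> diag X Y \<Longrightarrow> f \<alpha> \<beta> = \<alpha> \<bullet> (\<kappa> \<bullet> \<rho>) \<bullet> \<beta>"
begin

abbreviation R :: "partition set" where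
  "R \<equiv> sections C X \<rho>"

text \<open>Written through \<open>star\<close> so that counting and absorption for right inverses
  apply on this side too; \<open>L_iff\<close> gives the direct form as left inverses of
  \<kappa>.\<close>

abbreviation L :: "partition set" where
  "L \<equiv> star ` sections C Y (star \<kappa>)"

abbreviation S :: "partition set" where
  "S \<equiv> insert (idd C) (sing C)"

text \<open>This will be the idempotent-generated subsemigroup. Triples multiply as in the direct
  product of \<open>S\<close> with a rectangular band; no uniqueness of the coordinates is
  claimed.\<close>

definition Q :: "partition set" where
  "Q = {a \<bullet> s \<bullet> b | a s b. a \<in> R \<and> s \<in> S \<and> b \<in> L}"

text \<open>The factor \<open>idd C\<close> is kept so that the lemmas on triples apply
  literally.\<close>

definition Top :: "partition set" where
  "Top = {a \<bullet> idd C \<bullet> b | a b. a \<in> R \<and> b \<in> L}"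

text \<open>Recovers the middle coordinate (\<open>triple_phi\<close>) without a choice of the outer
  ones, and is multiplicative on \<open>Q\<close>.\<close>

definition \<phi> :: "partition \<Rightarrow> partition" where
  "\<phi> x = \<rho> \<bullet> x \<bullet> \<kappa>"

lemma fin: "finite C"
  using diag_finite(1)[OF rho] .

lemma R_iff: "a \<in> R \<longleftrightarrow> a \<in> diag X C \<and> \<rho> \<bullet> a = idd C"
  by (simp add: sections_def)

lemma L_iff: "b \<in> L \<longleftrightarrow> b \<in> diag C Y \<and> b \<bullet> \<kappa> = idd C"
proof -
  have *: "star \<kappa> \<bullet> c = idd C \<longleftrightarrow> star c \<bullet> \<kappa> = idd C" if "c \<in> diag Y C" for c
    using star_comp[OF star_diag[OF lam] that] star_comp[OF star_diag[OF that] lam] star_idd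
    by (metis star_star)
  show ?thesis
  proof
    assume "b \<in> L"
    then obtain c where "c \<in> diag Y C" "star \<kappa> \<bullet> c = idd C" "b = star c" by (auto simp: sections_def)
    then show "b \<in> diag C Y \<and> b \<bullet> \<kappa> = idd C" using * star_diag by blast
  next
    assume b: "b \<in> diag C Y \<and> b \<bullet> \<kappa> = idd C"
    then have "star b \<in> sections C Y (star \<kappa>)"
      using *[of "star b"] star_diag[of b C Y] by (simp add: sections_def)
    then show "b \<in> L" by (metis image_eqI star_star)
  qed
qed

lemma S_diag: "S \<subseteq> diag C C"
  using idd_diag[OF fin] by (auto simp: sing_def)

lemma S_comp: "s \<in> S \<Longrightarrow> t \<in> S \<Longrightarrow> s \<bullet> t \<in> S"
  using S_diag sing_comp comp_idd_left[of t C C] by auto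

lemma triple_diag:
  assumes "a \<in> R" "s \<in> diag C C" "b \<in> L"
  shows "a \<bullet> s \<bullet> b \<in> diag X Y"
  using assms unfolding R_iff L_iff by (blast intro: comp_diag)

lemma triple_lam:
  assumes "a \<in> R" "s \<in> diag C C" "b \<in> L"
  shows "a \<bullet> s \<bullet> b \<bullet> \<kappa> = a \<bullet> s"
proof -
  have as: "a \<bullet> s \<in> diag X C" using assms unfolding R_iff by (blast intro: comp_diag)
  then show ?thesis
    using comp_assoc[OF as _ lam, of b] comp_idd_right[OF as] assms(3) unfolding L_iff by simp
qed

lemma triple_phi:
  assumes "a \<in> R" "s \<in> diag C C" "b \<in> L"
  shows "\<phi> (a \<bullet> s \<bullet> b) = s"
proof -
  have a: "a \<in> diag X C" "\<rho> \<bullet> a = idd C" using assms(1) unfolding R_iff by auto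
  have "\<phi> (a \<bullet> s \<bullet> b) = \<rho> \<bullet> (a \<bullet> s)"
    unfolding \<phi>_def using comp_assoc[OF rho triple_diag[OF assms] lam] triple_lam[OF assms] by simp
  also have "\<dots> = s"
    using comp_assoc[OF rho a(1) assms(2)] a(2) comp_idd_left[OF assms(2)] by simp
  finally show ?thesis .
qed

text \<open>The inner part \<open>b \<bullet> \<kappa> \<bullet> \<rho> \<bullet> c\<close>
  collapses, because \<open>b\<close> inverts \<kappa> and \<open>c\<close> inverts \<rho>.\<close>

lemma triple_mult:
  assumes x: "a \<in> R" "s \<in> diag C C" "b \<in> L" and y: "c \<in> R" "t \<in> diag C C" "d \<in> L"
  shows "f (a \<bullet> s \<bullet> b) (c \<bullet> t \<bullet> d) = a \<bullet> (s \<bullet> t) \<bullet> d"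
proof -
  have a: "a \<in> diag X C" and c: "c \<in> diag X C" "\<rho> \<bullet> c = idd C" and d: "d \<in> diag C Y"
    using assms unfolding R_iff L_iff by auto
  have as: "a \<bullet> s \<in> diag X C" and td: "t \<bullet> d \<in> diag C Y"
    using a d x(2) y(2) by (blast intro: comp_diag)+
  have "f (a \<bullet> s \<bullet> b) (c \<bullet> t \<bullet> d) = a \<bullet> s \<bullet> b \<bullet> (\<kappa> \<bullet> \<rho>) \<bullet> (c \<bullet> t \<bullet> d)"
    using f_eq triple_diag assms by blast
  also have "\<dots> = a \<bullet> s \<bullet> \<rho> \<bullet> (c \<bullet> (t \<bullet> d))"
    using comp_assoc[OF triple_diag[OF x] lam rho] triple_lam[OF x] comp_assoc[OF c(1) y(2) d] by simp
  also have "a \<bullet> s \<bullet> \<rho> \<bullet> (c \<bullet> (t \<bullet> d)) = a \<bullet> s \<bullet> (\<rho> \<bullet> (c \<bullet> (t \<bullet> d)))"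
    by (rule comp_assoc[OF as rho comp_diag[OF c(1) td]])
  also have "\<rho> \<bullet> (c \<bullet> (t \<bullet> d)) = t \<bullet> d"
    using comp_assoc[OF rho c(1) td] c(2) comp_idd_left[OF td] by simp
  also have "a \<bullet> s \<bullet> (t \<bullet> d) = a \<bullet> s \<bullet> t \<bullet> d" by (rule comp_assoc[OF as y(2) d, symmetric])
  also have "a \<bullet> s \<bullet> t = a \<bullet> (s \<bullet> t)" by (rule comp_assoc[OF a x(2) y(2)])
  finally show ?thesis .
qed

lemma QE:
  assumes "x \<in> Q"
  obtains a s b where "a \<in> R" "s \<in> S" "s \<in> diag C C" "b \<in> L" "x = a \<bullet> s \<bullet> b"
  using assms S_diag unfolding Q_def by blast

lemma Q_closed: "x \<in> Q \<Longrightarrow> y \<in> Q \<Longrightarrow> f x y \<in> Q"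
proof -
  assume "x \<in> Q" "y \<in> Q"
  then obtain a s b c t d where *: "a \<in> R" "s \<in> S" "b \<in> L" "c \<in> R" "t \<in> S" "d \<in> L"
    "x = a \<bullet> s \<bullet> b" "y = c \<bullet> t \<bullet> d" unfolding Q_def by blast
  then have "f x y = a \<bullet> (s \<bullet> t) \<bullet> d" using triple_mult S_diag by blast
  then show "f x y \<in> Q" using * S_comp unfolding Q_def by blast
qed

lemma phi_mult:
  assumes "x \<in> Q" "y \<in> Q"
  shows "\<phi> (f x y) = \<phi> x \<bullet> \<phi> y"
proof -
  obtain a s b c t d where *: "a \<in> R" "s \<in> S" "b \<in> L" "c \<in> R" "t \<in> S" "d \<in> L"
    "x = a \<bullet> s \<bullet> b" "y = c \<bullet> t \<bullet> d" using assms unfolding Q_def by blast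
  then have st: "s \<in> diag C C" "t \<in> diag C C" using S_diag by auto
  show ?thesis
    using triple_phi[OF *(1) st(1) *(3)] triple_phi[OF *(4) st(2) *(6)]
      triple_phi[OF *(1) comp_diag[OF st] *(6)] triple_mult[OF *(1) st(1) *(3,4) st(2) *(6)] *(7,8)
    by simp
qed

lemma phi_Q:
  assumes "x \<in> Q"
  shows "\<phi> x \<in> S"
proof -
  obtain a s b where *: "a \<in> R" "s \<in> S" "b \<in> L" "x = a \<bullet> s \<bullet> b"
    using assms unfolding Q_def by blast
  have "s \<in> diag C C" using *(2) S_diag by blast
  then show ?thesis using triple_phi[OF *(1) _ *(3)] *(2,4) by simp
qed

lemma idempotent_in_Q:
  assumes e: "e \<in> diag X Y" "f e e = e"
  shows "e \<in> Q"
proof -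
  have el: "e \<bullet> \<kappa> \<in> diag X C" and re: "\<rho> \<bullet> e \<in> diag C Y"
    using comp_diag e(1) lam rho by blast+
  have e2: "e \<bullet> \<kappa> \<bullet> (\<rho> \<bullet> e) = e"
    using f_eq[OF e(1,1)] e(2) comp_assoc[OF e(1) lam rho] comp_assoc[OF el rho e(1)] by simp
  \<comment> \<open>By \<open>e2\<close>, \<open>\<rho> \<bullet> e\<close> is a right factor of
    \<open>e\<close>, so its lower hooks persist in \<open>e\<close>; this is what
    \<open>absorb\<close> asks for.\<close>
  have "{Prime i, Prime j} \<in> e" if "{Prime i, Prime j} \<in> \<rho> \<bullet> e" for i j
    using comp_lower_hook[OF el re that] e2 by simp
  then obtain a where a: "a \<in> R" "a \<bullet> (\<rho> \<bullet> e) = e"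
    using absorb[OF rho full_rho e(1)] by blast
  \<comment> \<open>The left-hand side is treated by reflection, which turns \<kappa> into a full
    diagram on the left.\<close>
  have se: "star (e \<bullet> \<kappa>) = star \<kappa> \<bullet> star e" by (rule star_comp[OF e(1) lam])
  have "{Prime i, Prime j} \<in> star e" if "{Prime i, Prime j} \<in> star \<kappa> \<bullet> star e" for i j
  proof -
    have "{Plain i, Plain j} \<in> e \<bullet> \<kappa>" using that unfolding se[symmetric] by (simp add: star_iff)
    then show ?thesis using comp_upper_hook[OF el re] e2 by (simp add: star_iff)
  qed
  then obtain b where b: "b \<in> sections C Y (star \<kappa>)" "b \<bullet> (star \<kappa> \<bullet> star e) = star e"
    using absorb[OF star_diag[OF lam] full_lam star_diag[OF e(1)]] by blast
  have bd: "b \<in> diag Y C" using b(1) by (simp add: sections_def)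
  have "e = star (b \<bullet> star (e \<bullet> \<kappa>))" using b(2) se by simp
  also have "\<dots> = e \<bullet> \<kappa> \<bullet> star b" using star_comp[OF bd star_diag[OF el]] by simp
  finally have b2: "e = e \<bullet> \<kappa> \<bullet> star b" .
  have bL: "star b \<in> L" using b(1) by blast
  have s: "\<phi> e \<in> diag C C" unfolding \<phi>_def by (rule comp_diag[OF re lam])
  have ad: "a \<in> diag X C" using a(1) by (simp add: R_iff)
  \<comment> \<open>Substituting \<open>a \<bullet> (\<rho> \<bullet> e)\<close> for
    \<open>e\<close> in \<open>e \<bullet> \<kappa>\<close> merges the two one-sided recoveries into
    a triple.\<close>
  have "a \<bullet> \<phi> e = e \<bullet> \<kappa>"
    unfolding \<phi>_def using comp_assoc[OF ad re lam] a(2) by simp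
  then have e3: "e = a \<bullet> \<phi> e \<bullet> star b" using b2 by simp
  then have "f e e = a \<bullet> (\<phi> e \<bullet> \<phi> e) \<bullet> star b"
    using triple_mult[OF a(1) s bL a(1) s bL] by simp
  then have "\<phi> e \<bullet> \<phi> e = \<phi> e"
    using triple_phi[OF a(1) comp_diag[OF s s] bL] e(2) by simp
  then have "\<phi> e \<in> S" using idempotent_full[OF s] s by (auto simp: sing_def)
  then show ?thesis using e3 a(1) bL unfolding Q_def by blast
qed

lemma Q_rank_lower:
  assumes A: "A \<subseteq> Q" "finite A" "gen f A = Q" and L: "L \<noteq> {}" "R \<noteq> {}"
  shows "card R + card (hooks C) \<le> card A"
proof -
  have gQ: "x \<in> Q" if "x \<in> gen f A" for x using that A(3) by simp
  \<comment> \<open>Following left factors down to a generator preserves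
    \<open>x \<bullet> \<kappa>\<close>, which is the coordinate \<open>a\<close> for elements of
    \<open>Top\<close>. So each \<open>a \<in> R\<close> needs a generator of its own.\<close>
  have top: "\<exists>y\<in>A \<inter> Top. y \<bullet> \<kappa> = x \<bullet> \<kappa>" if "x \<in> gen f A" "\<phi> x = idd C" for x
    using that
  proof induction
    case (base x)
    then have "x \<in> Q" using A(1) by blast
    then obtain a s b where x: "a \<in> R" "s \<in> diag C C" "b \<in> L" "x = a \<bullet> s \<bullet> b" by (rule QE)
    then have "s = idd C" using base(2) triple_phi[OF x(1,2,3)] by simp
    then have "x \<in> Top" using x unfolding Top_def by blast
    then show ?case using base(1) by blast
  next
    case (mult x y)
    have xy: "x \<in> Q" "y \<in> Q" using mult.hyps gQ by auto
    obtain a s b where 1: "a \<in> R" "s \<in> S" "s \<in> diag C C" "b \<in> L" "x = a \<bullet> s \<bullet> b"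
      using QE[OF xy(1)] .
    obtain c t d where 2: "c \<in> R" "t \<in> S" "t \<in> diag C C" "d \<in> L" "y = c \<bullet> t \<bullet> d"
      using QE[OF xy(2)] .
    note * = 1(1,2,4) 2(1,2,4) 1(5) 2(5) and st = 1(3) 2(3)
    have \<phi>: "\<phi> x = s" "\<phi> y = t" using triple_phi[OF 1(1,3,4)] triple_phi[OF 2(1,3,4)] 1 2 by simp_all
    have stid: "s \<bullet> t = idd C" using phi_mult[OF xy] mult.prems \<phi> by simp
    \<comment> \<open>A singular left factor would make the product singular.\<close>
    then have s: "s = idd C" using *(2) sing_comp[OF _ st(2)] idd_not_sing[of C] by (metis insertE)
    have "f x y \<bullet> \<kappa> = a \<bullet> (s \<bullet> t)"
      using triple_mult[OF *(1) st(1) *(3,4) st(2) *(6)] triple_lam[OF *(1) comp_diag[OF st] *(6)] *(7,8) by simp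
    also have "\<dots> = x \<bullet> \<kappa>" using triple_lam[OF *(1) st(1) *(3)] s stid *(7) by simp
    finally show ?case using mult.IH(1) \<phi>(1) s by simp
  qed
  have idd: "idd C \<in> diag C C" by (rule idd_diag[OF fin])
  have "R \<subseteq> (\<lambda>y. y \<bullet> \<kappa>) ` (A \<inter> Top)"
  proof
    fix a assume a: "a \<in> R"
    obtain b where b: "b \<in> L" using L by blast
    let ?x = "a \<bullet> idd C \<bullet> b"
    have "?x \<in> gen f A" using a b A(3) unfolding Q_def by blast
    then obtain y where y: "y \<in> A \<inter> Top" "y \<bullet> \<kappa> = ?x \<bullet> \<kappa>"
      using top triple_phi[OF a idd b] by blast
    have "?x \<bullet> \<kappa> = a" using triple_lam[OF a idd b] comp_idd_right[of a X C] a R_iff by simp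
    then show "a \<in> (\<lambda>y. y \<bullet> \<kappa>) ` (A \<inter> Top)" using y by force
  qed
  then have 1: "card R \<le> card (A \<inter> Top)" using A(2) by (intro surj_card_le) auto
  \<comment> \<open>Left factors with trivial middle coordinate are passed over; the first other
    generator hands its upper hooks on to the product.\<close>
  have low: "\<exists>y\<in>A - Top. upper (\<phi> y) \<noteq> {} \<and> upper (\<phi> y) \<subseteq> upper (\<phi> x)"
    if "x \<in> gen f A" "\<phi> x \<in> sing C" for x
    using that
  proof induction
    case (base x)
    have "\<phi> y = idd C" if "y \<in> Top" for y
      using that triple_phi[OF _ idd] unfolding Top_def by auto
    then have "x \<notin> Top" using base(2) idd_not_sing[of C] by metis
    moreover have "upper (\<phi> x) \<noteq> {}" using base(2) by (auto simp: sing_def full_def upper_def)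
    ultimately show ?case using base(1) by blast
  next
    case (mult x y)
    have xy: "x \<in> Q" "y \<in> Q" using mult.hyps gQ by auto
    have st: "\<phi> x \<in> diag C C" "\<phi> y \<in> diag C C" using phi_Q[OF xy(1)] phi_Q[OF xy(2)] S_diag by blast+
    show ?case
    proof (cases "\<phi> x \<in> sing C")
      case True
      have "upper (\<phi> x) \<subseteq> upper (\<phi> (f x y))"
        unfolding phi_mult[OF xy] upper_def using comp_upper_hook[OF st] by blast
      then show ?thesis using mult.IH(1)[OF True] by blast
    next
      case False
      then have "\<phi> x = idd C" using phi_Q[OF xy(1)] by simp
      then have "\<phi> (f x y) = \<phi> y" using phi_mult[OF xy] comp_idd_left[OF st(2)] by simp
      then show ?thesis using mult.IH(2) mult.prems by simp
    qed
  qed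
  have "upper ` hooks C \<subseteq> (\<lambda>y. upper (\<phi> y)) ` (A - Top)"
  proof
    fix U assume "U \<in> upper ` hooks C"
    then obtain i j where ij: "i \<in> C" "j \<in> C" "i \<noteq> j" "U = {{i, j}}" "U = upper (hook C i j)"
      by (auto simp: hooks_def upper_hook)
    obtain a b where ab: "a \<in> R" "b \<in> L" using L by blast
    have h: "hook C i j \<in> sing C" "hook C i j \<in> diag C C"
      using hook_sing[OF fin ij(1-3)] hook_diag[OF fin ij(1-3)] by auto
    let ?x = "a \<bullet> hook C i j \<bullet> b"
    have "?x \<in> gen f A" using ab h A(3) unfolding Q_def by blast
    then obtain y where y: "y \<in> A - Top" "upper (\<phi> y) \<noteq> {}" "upper (\<phi> y) \<subseteq> U"
      using low[of ?x] triple_phi[OF ab(1) h(2) ab(2)] h(1) ij(5) by auto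
    \<comment> \<open>\<open>U\<close> is a singleton, so a non-empty subset of it is all of
      it.\<close>
    then have "upper (\<phi> y) = U" using ij(4) by auto
    then show "U \<in> (\<lambda>y. upper (\<phi> y)) ` (A - Top)" using y(1) by blast
  qed
  then have "card (upper ` hooks C) \<le> card (A - Top)" using A(2) by (intro surj_card_le) auto
  then have 2: "card (hooks C) \<le> card (A - Top)" using card_image[OF inj_on_upper_hooks] by simp
  have "card A = card (A \<inter> Top) + card (A - Top)"
    using A(2) card_Un_disjoint[of "A \<inter> Top" "A - Top"] by (simp add: Int_Diff_Un Int_Diff_disjoint)
  then show ?thesis using 1 2 by simp
qed

text \<open>To generate a rectangular band it suffices to meet every row and every column, which one
  idempotent per row does when \<open>g\<close> is onto. The hooks are placed at a single position
  \<open>(a0, b0)\<close>; multiplication by elements of \<open>Top\<close> moves their products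
  anywhere.\<close>

lemma Q_idempotent_generators:
  assumes "L \<noteq> {}" "R \<noteq> {}" "card L \<le> card R"
  obtains A where "A \<subseteq> idempotents f (diag X Y)" "finite A" "card A \<le> card R + card (hooks C)" "gen f A = Q"
proof -
  have finR: "finite R" and finL: "finite L"
    using finite_diag by (auto simp: sections_def)
  have finH: "finite (hooks C)"
    using finite_subset[of "hooks C" "diag C C"] finite_diag hook_diag[OF fin] by (auto simp: hooks_def)
  obtain g where g: "g ` R = L" using ex_surj_on[OF finR finL assms(3,1)] .
  obtain a0 b0 where ab: "a0 \<in> R" "b0 \<in> L" using assms by blast
  let ?A = "(\<lambda>a. a \<bullet> idd C \<bullet> g a) ` R" and ?B = "(\<lambda>h. a0 \<bullet> h \<bullet> b0) ` hooks C"
  have idd: "idd C \<in> diag C C" by (rule idd_diag[OF fin])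
  have ii: "idd C \<bullet> idd C = idd C" by (rule comp_idd_left[OF idd])
  have hd: "h \<in> diag C C" "h \<in> sing C" "h \<bullet> h = h" if "h \<in> hooks C" for h
    using that hook_diag[OF fin] hook_sing[OF fin] hook_idem[OF fin] by (auto simp: hooks_def)
  have gL: "g a \<in> L" if "a \<in> R" for a using g that by blast
  have "?A \<subseteq> idempotents f (diag X Y)"
  proof (rule image_subsetI)
    fix a assume a: "a \<in> R"
    show "a \<bullet> idd C \<bullet> g a \<in> idempotents f (diag X Y)"
      using triple_mult[OF a idd gL[OF a] a idd gL[OF a]] triple_diag[OF a idd gL[OF a]] ii
      by (simp add: idempotents_def)
  qed
  moreover have "?B \<subseteq> idempotents f (diag X Y)"
  proof (rule image_subsetI)
    fix h assume h: "h \<in> hooks C"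
    show "a0 \<bullet> h \<bullet> b0 \<in> idempotents f (diag X Y)"
      using triple_mult[OF ab(1) hd(1)[OF h] ab(2,1) hd(1)[OF h] ab(2)]
        triple_diag[OF ab(1) hd(1)[OF h] ab(2)] hd(3)[OF h]
      by (simp add: idempotents_def)
  qed
  ultimately have 1: "?A \<union> ?B \<subseteq> idempotents f (diag X Y)" by blast
  have AB: "?A \<union> ?B \<subseteq> Q" using gL ab hd(2) unfolding Q_def by blast
  have 2: "gen f (?A \<union> ?B) \<subseteq> Q"
  proof
    fix x assume "x \<in> gen f (?A \<union> ?B)"
    then show "x \<in> Q" using AB Q_closed by (rule gen_closed)
  qed
  have top: "a \<bullet> idd C \<bullet> b \<in> gen f (?A \<union> ?B)" if m: "a \<in> R" "b \<in> L" for a b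
  proof -
    obtain c where c: "c \<in> R" "b = g c" using g m(2) by blast
    have "f (a \<bullet> idd C \<bullet> g a) (c \<bullet> idd C \<bullet> g c) = a \<bullet> idd C \<bullet> b"
      using triple_mult[OF m(1) idd gL[OF m(1)] c(1) idd gL[OF c(1)]] c(2) ii by simp
    moreover have "f (a \<bullet> idd C \<bullet> g a) (c \<bullet> idd C \<bullet> g c) \<in> gen f (?A \<union> ?B)"
      using m(1) c(1) by (intro gen.intros) auto
    ultimately show ?thesis by simp
  qed
  have "s \<in> diag C C \<and> a0 \<bullet> s \<bullet> b0 \<in> gen f (?A \<union> ?B)" if "s \<in> gen (\<bullet>) (hooks C)" for s
    using that
  proof induction
    case (base s)
    then show ?case using hd by (auto intro: gen.base)
  next
    case (mult s t)
    then have st: "s \<in> diag C C" "t \<in> diag C C"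
      and "f (a0 \<bullet> s \<bullet> b0) (a0 \<bullet> t \<bullet> b0) \<in> gen f (?A \<union> ?B)"
      by (auto intro: gen.mult)
    then show ?case using triple_mult[OF ab(1) st(1) ab(2,1) st(2) ab(2)] comp_diag[OF st] by simp
  qed
  note low = this[OF sing_gen_hooks]
  have 3: "Q \<subseteq> gen f (?A \<union> ?B)"
  proof
    fix x assume "x \<in> Q"
    then obtain a s b where x: "a \<in> R" "s \<in> S" "b \<in> L" "x = a \<bullet> s \<bullet> b" unfolding Q_def by blast
    show "x \<in> gen f (?A \<union> ?B)"
    proof (cases "s = idd C")
      case True
      then show ?thesis using top x by simp
    next
      case False
      then have s: "s \<in> diag C C" "a0 \<bullet> s \<bullet> b0 \<in> gen f (?A \<union> ?B)" using low x(2) by auto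
      have "f (a \<bullet> idd C \<bullet> b0) (a0 \<bullet> s \<bullet> b0) = a \<bullet> s \<bullet> b0"
        using triple_mult[OF x(1) idd ab(2,1) s(1) ab(2)] comp_idd_left[OF s(1)] by simp
      moreover have "f (a \<bullet> s \<bullet> b0) (a0 \<bullet> idd C \<bullet> b) = x"
        using triple_mult[OF x(1) s(1) ab(2,1) idd x(3)] comp_idd_right[OF s(1)] x(4) by simp
      ultimately show ?thesis
        using gen.mult[OF gen.mult[OF top[OF x(1) ab(2)] s(2)] top[OF ab(1) x(3)]] by simp
    qed
  qed
  have "card (?A \<union> ?B) \<le> card ?A + card ?B" by (rule card_Un_le)
  also have "\<dots> \<le> card R + card (hooks C)"
    using card_image_le[OF finR] card_image_le[OF finH] by (rule add_mono)
  finally show thesis using that 1 2 3 finR finH by blast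
qed

text \<open>The lower bound concerns arbitrary generating sets and is attained by idempotents, so
  the two minima agree.\<close>

theorem ranks:
  assumes "L \<noteq> {}" "R \<noteq> {}" "card L \<le> card R"
  shows "sg_rank f (idem_gen f (diag X Y)) = card R + card (hooks C)"
    and "sg_idrank f (idem_gen f (diag X Y)) = card R + card (hooks C)"
proof -
  obtain A where A: "A \<subseteq> idempotents f (diag X Y)" "finite A"
    "card A \<le> card R + card (hooks C)" "gen f A = Q"
    using Q_idempotent_generators[OF assms] .
  have "idempotents f (diag X Y) \<subseteq> Q" using idempotent_in_Q by (auto simp: idempotents_def)
  then have "x \<in> Q" if "x \<in> idem_gen f (diag X Y)" for x
    using that[unfolded idem_gen_def] Q_closed by (intro gen_closed[of x f _ Q]) blast+
  then have "idem_gen f (diag X Y) \<subseteq> Q" by blast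
  moreover have "Q \<subseteq> idem_gen f (diag X Y)"
    using gen_mono[OF A(1)] A(4) unfolding idem_gen_def by blast
  ultimately have E: "idem_gen f (diag X Y) = Q" by blast
  have AQ: "A \<subseteq> Q" using A(4) by (blast intro: gen.base)
  then have AI: "A \<subseteq> idempotents f Q" using A(1) by (auto simp: idempotents_def)
  have c: "card A = card R + card (hooks C)" using Q_rank_lower[OF AQ A(2,4) assms(1,2)] A(3) by simp
  show "sg_rank f (idem_gen f (diag X Y)) = card R + card (hooks C)"
    unfolding E sg_rank_def
  proof (rule Least_equality)
    show "\<exists>A\<subseteq>Q. finite A \<and> card A = card R + card (hooks C) \<and> gen f A = Q"
      using AQ A c by blast
  next
    fix k assume "\<exists>A\<subseteq>Q. finite A \<and> card A = k \<and> gen f A = Q"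
    then obtain B where "B \<subseteq> Q" "finite B" "card B = k" "gen f B = Q" by blast
    then show "card R + card (hooks C) \<le> k" using Q_rank_lower[OF _ _ _ assms(1,2)] by blast
  qed
  show "sg_idrank f (idem_gen f (diag X Y)) = card R + card (hooks C)"
    unfolding E sg_idrank_def
  proof (rule Least_equality)
    show "\<exists>A\<subseteq>idempotents f Q. finite A \<and> card A = card R + card (hooks C) \<and> gen f A = Q"
      using AI A c by blast
  next
    fix k assume "\<exists>A\<subseteq>idempotents f Q. finite A \<and> card A = k \<and> gen f A = Q"
    then obtain B where B: "B \<subseteq> idempotents f Q" "finite B" "card B = k" "gen f B = Q" by blast
    then have "B \<subseteq> Q" by (auto simp: idempotents_def)
    then show "card R + card (hooks C) \<le> k" using Q_rank_lower[OF _ B(2,4) assms(1,2)] B(3) by simp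
  qed
qed

end

section \<open>Double factorials and the factorisation of \<sigma>\<close>

lemma dfact_pos: "dfact k > 0"
proof (induction k rule: dfact.induct)
  case (1 k)
  then show ?case by (subst dfact.simps) auto
qed

text \<open>The bound on \<open>k\<close> makes each factor that a step of two adds at least
  1.\<close>

lemma dfact_mono_even:
  assumes "k \<ge> -1"
  shows "dfact k \<le> dfact (k + 2 * int j)"
proof (induction j)
  case (Suc j)
  let ?k = "k + 2 * int (Suc j)"
  have "dfact ?k = nat ?k * dfact (k + 2 * int j)"
    using assms by (subst dfact.simps) (simp add: algebra_simps)
  moreover have "nat ?k \<ge> 1" using assms by simp
  ultimately have "dfact (k + 2 * int j) \<le> dfact ?k" by simp
  with Suc show ?case by (rule order_trans)
qed simp

lemma matching_subset:
  assumes "matching V M" "N \<subseteq> M"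
  shows "matching (\<Union>N) N"
  using assms matching_block[OF assms(1)] matching_unique[OF assms(1)]
  by (intro matchingI) (blast, simp, blast)

lemma full_factorization:
  assumes \<sigma>: "\<sigma> \<in> diag Y X"
  obtains C \<kappa> \<rho> where "card C = prank \<sigma>" "\<kappa> \<in> diag Y C" "\<rho> \<in> diag C X" "full \<rho>" "full (star \<kappa>)"
    "\<kappa> \<bullet> \<rho> = \<sigma>"
proof -
  note m = diag_matching[OF \<sigma>]
  \<comment> \<open>With the lower ends of the transversals as middle row, \<kappa> can be the
    subset \<open>\<sigma> - N\<close> without renaming; \<rho> consists of identity strands and the
    lower hooks \<open>N\<close>.\<close>
  define C where "C = {y. \<exists>x. {Plain x, Prime y} \<in> \<sigma>}"
  define N where "N = {B \<in> \<sigma>. B \<subseteq> range Prime}"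
  have CX: "C \<subseteq> X"
  proof
    fix y assume "y \<in> C"
    then obtain x where "{Plain x, Prime y} \<in> \<sigma>" by (auto simp: C_def)
    then show "y \<in> X" using matching_mem[OF m, of "Plain x" "Prime y"] by simp
  qed
  have fin: "finite X" "finite Y" using diag_finite[OF \<sigma>] by auto
  have finC: "finite C" using finite_subset[OF CX fin(1)] .
  have UN: "\<Union>N = Prime ` (X - C)"
  proof (intro subset_antisym subsetI)
    fix v assume "v \<in> \<Union>N"
    then obtain B where B: "B \<in> \<sigma>" "B \<subseteq> range Prime" "v \<in> B" by (auto simp: N_def)
    then obtain y where y: "v = Prime y" by blast
    then have "y \<in> X" using B matching_Union[OF m] by (metis UnionI pts_simps(2))
    moreover have "y \<notin> C"
    proof
      assume "y \<in> C"
      then obtain x where "{Prime y, Plain x} \<in> \<sigma>" by (auto simp: C_def insert_commute)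
      then have "B = {Prime y, Plain x}" using matching_block_eq[OF m B(1)] B(3) y by blast
      then show False using B(2) by auto
    qed
    ultimately show "v \<in> Prime ` (X - C)" using y by blast
  next
    fix v assume "v \<in> Prime ` (X - C)"
    then obtain y where y: "v = Prime y" "y \<in> X" "y \<notin> C" by blast
    then have "v \<in> pts Y X" by simp
    then obtain w where w: "{v, w} \<in> \<sigma>" using matching_partner[OF m] by blast
    then have "w \<in> pts Y X" using matching_mem[OF m] by blast
    moreover have "w \<noteq> Plain x" for x using w y by (auto simp: C_def insert_commute)
    ultimately have "w \<in> range Prime" by (auto elim!: ptsE)
    then have "{v, w} \<in> N" using w y by (simp add: N_def)
    then show "v \<in> \<Union>N" by blast
  qed
  have "matching (pts C C \<union> \<Union>N) (idd C \<union> N)"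
  proof (rule matching_Un[OF diag_matching[OF idd_diag[OF finC]] matching_subset[OF m]])
    show "N \<subseteq> \<sigma>" by (auto simp: N_def)
    show "pts C C \<inter> \<Union>N = {}" unfolding UN by (auto simp: pts_def)
  qed
  moreover have "pts C C \<union> \<Union>N = pts C X" unfolding UN using CX by (auto simp: pts_def)
  ultimately have \<rho>: "idd C \<union> N \<in> diag C X" using fin finC by (simp add: diag_def)
  have ml: "matching (\<Union>(\<sigma> - N)) (\<sigma> - N)" by (rule matching_subset[OF m]) blast
  have "\<Union>(\<sigma> - N) = \<Union>\<sigma> - \<Union>N"
  proof -
    have "A \<inter> B = {}" if "A \<in> \<sigma> - N" "B \<in> N" for A B
      using that m disjointD[of \<sigma> A B] by (auto simp: N_def matching_def partition_on_def)
    then show ?thesis by blast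
  qed
  also have "\<dots> = pts Y C"
    unfolding UN matching_Union[OF m] using CX by (auto simp: pts_def)
  finally have \<kappa>: "\<sigma> - N \<in> diag Y C" using ml fin finC by (simp add: diag_def)
  have "(\<sigma> - N) \<bullet> (idd C \<union> N) = \<sigma>"
  proof (rule comp_eqI[OF \<kappa> \<rho> \<sigma>])
    let ?l = "\<sigma> - N" and ?r = "idd C \<union> N"
    have r: "con ?l ?r u (lower_vertex u)" if "u \<in> pts Y C" for u
      by (rule con_idd_lower[OF _ that]) simp
    fix u v assume uv: "{u, v} \<in> \<sigma>"
    show "con ?l ?r u v"
    proof (cases "{u, v} \<in> N")
      case True
      then have "u \<in> range Prime" "v \<in> range Prime" by (auto simp: N_def)
      then show ?thesis using con_raise[of u v ?r ?l] True by auto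
    next
      case False
      then have uv': "{u, v} \<in> ?l" using uv by blast
      have "u \<in> pts Y C" "v \<in> pts Y C" using matching_mem[OF diag_matching[OF \<kappa>] uv'] by auto
      then show ?thesis by (intro con_via[OF r con_lower[OF uv'] r])
    qed
  qed
  moreover have "full (idd C \<union> N)" by (auto simp: full_def idd_iff N_def)
  moreover have "full (star (\<sigma> - N))" by (auto simp: full_star N_def)
  moreover have "card C = prank \<sigma>"
  proof -
    have "\<forall>y\<in>C. \<exists>x. {Plain x, Prime y} \<in> \<sigma>" by (simp add: C_def)
    then obtain g where g: "\<forall>y\<in>C. {Plain (g y), Prime y} \<in> \<sigma>" by (rule bchoice[THEN exE])
    have "{B \<in> \<sigma>. B \<inter> range Plain \<noteq> {} \<and> B \<inter> range Prime \<noteq> {}} = (\<lambda>y. {Plain (g y), Prime y}) ` C"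
    proof (intro subset_antisym subsetI)
      fix B assume "B \<in> {B \<in> \<sigma>. B \<inter> range Plain \<noteq> {} \<and> B \<inter> range Prime \<noteq> {}}"
      then obtain x y where B: "B \<in> \<sigma>" "Plain x \<in> B" "Prime y \<in> B" by blast
      obtain u v where "B = {u, v}" using matching_block[OF m B(1)] by blast
      then have "B = {Plain x, Prime y}" using B by auto
      then have "y \<in> C" using B by (auto simp: C_def)
      then have "B = {Prime y, Plain (g y)}"
        using matching_block_eq[OF m B(1,3), of "Plain (g y)"] g by (simp add: insert_commute)
      then show "B \<in> (\<lambda>y. {Plain (g y), Prime y}) ` C" using \<open>y \<in> C\<close> by (auto simp: insert_commute)
    qed (use g in auto)
    moreover have "inj_on (\<lambda>y. {Plain (g y), Prime y}) C" by (auto simp: inj_on_def doubleton_eq_iff)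
    ultimately show ?thesis by (simp add: prank_def card_image)
  qed
  ultimately show thesis using that \<kappa> \<rho> by blast
qed

theorem theorem6p30:
  fixes m n r :: nat and \<sigma> :: partition
  assumes "m mod 2 = n mod 2"
    and "\<sigma> \<in> brauer n m"
    and "r = prank \<sigma>"
    and "m \<ge> n"
  shows "sg_rank (sandwich m n \<sigma>) (idem_gen (sandwich m n \<sigma>) (brauer m n)) =
           sg_idrank (sandwich m n \<sigma>) (idem_gen (sandwich m n \<sigma>) (brauer m n)) \<and>
         real (sg_idrank (sandwich m n \<sigma>) (idem_gen (sandwich m n \<sigma>) (brauer m n))) =
           real (dfact (int m + int r - 1)) / real (dfact (2 * int r - 1)) + real (r choose 2)"
proof -
  let ?X = "{1..m}" and ?Y = "{1..n}" and ?f = "sandwich m n \<sigma>"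
  have \<sigma>: "\<sigma> \<in> diag ?Y ?X" using assms(2) by (simp add: brauer_diag)
  obtain C \<kappa> \<rho> where C: "card C = r" and lr: "\<kappa> \<in> diag ?Y C" "\<rho> \<in> diag C ?X" "full \<rho>" "full (star \<kappa>)"
    and eq: "\<kappa> \<bullet> \<rho> = \<sigma>"
    using full_factorization[OF \<sigma>] assms(3) by metis
  interpret factored_sandwich ?X ?Y C \<kappa> \<rho> ?f
  proof (unfold_locales)
    fix \<alpha> \<beta> assume ab: "\<alpha> \<in> diag ?X ?Y" "\<beta> \<in> diag ?X ?Y"
    have "\<alpha> \<bullet> \<sigma> \<in> diag ?X ?X" by (rule comp_diag[OF ab(1) \<sigma>])
    then show "sandwich m n \<sigma> \<alpha> \<beta> = \<alpha> \<bullet> (\<kappa> \<bullet> \<rho>) \<bullet> \<beta>"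
      using ab \<sigma> by (simp add: sandwich_def pprod_comp eq)
  qed (use lr in auto)
  have R: "card R * dfact (2 * int r - 1) = dfact (int m + int r - 1)"
    using card_sections[OF lr(2,3)] C by simp
  \<comment> \<open>Reflection is injective, so the left inverses are counted by the same formula
    with \<open>n\<close> in place of \<open>m\<close>.\<close>
  have "inj_on star (sections C ?Y (star \<kappa>))" by (metis inj_onI star_star)
  then have L: "card L * dfact (2 * int r - 1) = dfact (int n + int r - 1)"
    using card_sections[OF star_diag[OF lr(1)] lr(4)] C by (simp add: card_image)
  \<comment> \<open>The double factorials are positive, so neither set of inverses is empty.\<close>
  have ne: "L \<noteq> {}" "R \<noteq> {}"
    using L R dfact_pos[of "int n + int r - 1"] dfact_pos[of "int m + int r - 1"] by force+
  \<comment> \<open>Equal parity puts both double factorials into one chain of steps of two, so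
    \<open>m \<ge> n\<close> yields \<open>card L \<le> card R\<close>.\<close>
  obtain j where "m - n = 2 * j"
    using assms(1,4) by (metis dvdE mod_eq_dvd_iff_nat)
  then have "int m + int r - 1 = (int n + int r - 1) + 2 * int j" using assms(4) by linarith
  moreover have "dfact (int n + int r - 1) \<le> dfact ((int n + int r - 1) + 2 * int j)"
    by (rule dfact_mono_even) simp
  ultimately have "dfact (int n + int r - 1) \<le> dfact (int m + int r - 1)" by (simp only:)
  then have "card L \<le> card R" using L R dfact_pos[of "2 * int r - 1"] by (metis mult_le_cancel2)
  note ranks = ranks[OF ne this]
  have "real (card R) = real (dfact (int m + int r - 1)) / real (dfact (2 * int r - 1))"
    using dfact_pos[of "2 * int r - 1"] by (simp add: R[symmetric])
  then show ?thesis
    using ranks card_hooks[OF fin] C by (simp add: brauer_diag)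
qed

end
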